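(* Let $\mathbf{A}$ be a finite representable relation algebra with a flexible atom. Then there exists a finite integral representable relation algebra $\mathbf{A}'$ with a flexible atom such that the following statements hold: (1) There exists a polynomial-time many-one reduction from $\mathrm{NSP}(\mathbf{A})$ to $\mathrm{NSP}(\mathbf{A}')$. (2) There exists a polynomial-time many-one reduction from $\mathrm{NSP}(\mathbf{A}')$ to $\mathrm{NSP}(\mathbf{A})$. (3) The atom structure of $\mathbf{A}$ has a polymorphism that satisfies the Siggers identity if and only if the atom structure of $\mathbf{A}'$ has such a polymorphism.
   Context: Representable relation algebras. For a set $D$ and an equivalence relation $E$ on $D$, consider the algebra on $\mathcal{P}(E)$ with operations $\cup$, $\bar{a}=E\setminus a$, constants $0=\emptyset$, $1=E$, $\mathrm{Id}=\{(x,x)\mid x\in D\}$, converse $a^\smile=\{(x,y)\mid (y,x)\in a\}$, and composition $a\circ b=\{(x,z)\mid \exists y\in D: (x,y)\in a,\ (y,z)\in b\}$. Subalgebras of such algebras are proper relation algebras; a representable relation algebra is an algebra isomorphic to a proper relation algebra. For such $\mathbf{A}$ with domain $A$, $x\le y$ iff $x\cup y=y$; atoms are the minimal elements of $A\setminus\{0\}$, and $A_0$ is the set of atoms. $\mathbf{A}$ is integral if $\mathrm{Id}$ is an atom. With $I=\{a\in A\mid a\le \mathrm{Id}\}$, an atom $s\in A_0\setminus I$ is flexible if $s\le a\circ b$ for all $a,b\in A\setminus I$. A representation of $\mathbf{A}$ is a relational structure $\mathfrak{B}$ with domain $B$ and a binary relation $a^{\mathfrak{B}}$ for each $a\in A$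 such that $a\mapsto a^{\mathfrak{B}}$ is an isomorphism from $\mathbf{A}$ onto a proper relation algebra. An $\mathbf{A}$-network $(V;g)$ is a finite set $V$ with a partial function $g$ from $V^2$ to $A$; it is satisfiable if there are a representation $\mathfrak{B}$ of $\mathbf{A}$ and a map $t\colon V\to B$ with $(t(x),t(y))\in g(x,y)^{\mathfrak{B}}$ for all $(x,y)$ in the domain of $g$. $\mathrm{NSP}(\mathbf{A})$ is the problem of deciding whether a given $\mathbf{A}$-network is satisfiable. The atom structure of $\mathbf{A}$ is the relational structure $\mathfrak{O}$ with domain $A_0$ and the relations: for each $x\in A$ the unary relation $\{a\in A_0\mid a\le x\}$; the binary relation $\{(a_1,a_2)\in A_0^2\mid a_1^\smile=a_2\}$; the ternary relation $\{(a_1,a_2,a_3)\in A_0^3\mid a_3\le a_1\circ a_2\}$. A polymorphism of a structure is a finitary operation on its domain preserving all its relations. A 6-ary operation $f$ satisfies the Siggers identity if $f(x,x,y,y,z,z)=f(y,z,x,z,x,y)$ for all $x,y,z$. *)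

theory Defs
  imports "HOL-Computational_Algebra.Polynomial" "HOL-Library.Countable_Set"
begin

section \<open>Relation algebras and their representations\<close>

record 'a rel_alg =
  carrier :: "'a set"
  join :: "'a \<Rightarrow> 'a \<Rightarrow> 'a"
  compl :: "'a \<Rightarrow> 'a"
  zero :: 'a
  one :: 'a
  ident :: 'a
  conv :: "'a \<Rightarrow> 'a"
  comp :: "'a \<Rightarrow> 'a \<Rightarrow> 'a"

definition closed_under_ops :: "'a rel_alg \<Rightarrow> 'a set \<Rightarrow> bool" where
  "closed_under_ops A X \<longleftrightarrow>
     zero A \<in> X \<and> one A \<in> X \<and> ident A \<in> X \<and>
     (\<forall>x\<in>X. compl A x \<in> X \<and> conv A x \<in> X) \<and>
     (\<forall>x\<in>X. \<forall>y\<in>X. join A x y \<in> X \<and> comp A x y \<in> X)"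

definition full_rel_alg :: "'d set \<Rightarrow> ('d \<times> 'd) set \<Rightarrow> ('d \<times> 'd) set rel_alg" where
  "full_rel_alg D E =
     \<lparr>carrier = Pow E, join = (\<union>), compl = (\<lambda>a. E - a), zero = {}, one = E,
      ident = Id_on D, conv = converse, comp = (O)\<rparr>"

definition proper_rel_alg :: "'d set \<Rightarrow> ('d \<times> 'd) set rel_alg \<Rightarrow> bool" where
  "proper_rel_alg D P \<longleftrightarrow>
     (\<exists>E X. equiv D E \<and> X \<subseteq> carrier (full_rel_alg D E) \<and>
        closed_under_ops (full_rel_alg D E) X \<and> P = (full_rel_alg D E)\<lparr>carrier := X\<rparr>)"

definition rel_alg_iso :: "('a \<Rightarrow> 'b) \<Rightarrow> 'a rel_alg \<Rightarrow> 'b rel_alg \<Rightarrow> bool" where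
  "rel_alg_iso h A P \<longleftrightarrow>
     bij_betw h (carrier A) (carrier P) \<and>
     h (zero A) = zero P \<and> h (one A) = one P \<and> h (ident A) = ident P \<and>
     (\<forall>x\<in>carrier A. h (compl A x) = compl P (h x) \<and> h (conv A x) = conv P (h x)) \<and>
     (\<forall>x\<in>carrier A. \<forall>y\<in>carrier A.
        h (join A x y) = join P (h x) (h y) \<and> h (comp A x y) = comp P (h x) (h y))"

text \<open>The operations of a record are total functions on the type, so that the carrier is an
  algebra has to be required separately.\<close>

definition representation :: "'a rel_alg \<Rightarrow> 'd set \<Rightarrow> ('a \<Rightarrow> ('d \<times> 'd) set) \<Rightarrow> bool" where
  "representation A B r \<longleftrightarrow>
     closed_under_ops A (carrier A) \<and> (\<exists>P. proper_rel_alg B P \<and> rel_alg_iso r A P)"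

text \<open>Types cannot be quantified inside a formula, so the domain of a representation is taken to
  be a set of natural numbers. Lemmas \<open>representableI\<close> and \<open>satisfiableI\<close> below show that, for
  algebras with countably many elements, this loses nothing: representations on an arbitrary type
  can be replaced by countable ones.\<close>

definition representable :: "'a rel_alg \<Rightarrow> bool" where
  "representable A \<longleftrightarrow> (\<exists>(B :: nat set) r. representation A B r)"

definition leq :: "'a rel_alg \<Rightarrow> 'a \<Rightarrow> 'a \<Rightarrow> bool" where
  "leq A x y \<longleftrightarrow> join A x y = y"

definition atoms :: "'a rel_alg \<Rightarrow> 'a set" where
  "atoms A = {x \<in> carrier A - {zero A}. \<forall>y\<in>carrier A - {zero A}. leq A y x \<longrightarrow> y = x}"

definition integral :: "'a rel_alg \<Rightarrow> bool" where
  "integral A \<longleftrightarrow> ident A \<in> atoms A"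

definition subidentities :: "'a rel_alg \<Rightarrow> 'a set" where
  "subidentities A = {a \<in> carrier A. leq A a (ident A)}"

definition flexible :: "'a rel_alg \<Rightarrow> 'a \<Rightarrow> bool" where
  "flexible A s \<longleftrightarrow> s \<in> atoms A - subidentities A \<and>
     (\<forall>a\<in>carrier A - subidentities A. \<forall>b\<in>carrier A - subidentities A. leq A s (comp A a b))"


section \<open>The network satisfaction problem\<close>

definition network :: "'a rel_alg \<Rightarrow> 'v set \<Rightarrow> ('v \<times> 'v \<rightharpoonup> 'a) \<Rightarrow> bool" where
  "network A V g \<longleftrightarrow> finite V \<and> dom g \<subseteq> V \<times> V \<and> ran g \<subseteq> carrier A"

definition satisfied_in ::
    "'a rel_alg \<Rightarrow> 'd set \<Rightarrow> ('a \<Rightarrow> ('d \<times> 'd) set) \<Rightarrow> 'v set \<Rightarrow> ('v \<times> 'v \<rightharpoonup> 'a) \<Rightarrow> bool" where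
  "satisfied_in A B r V g \<longleftrightarrow> representation A B r \<and>
     (\<exists>t. t ` V \<subseteq> B \<and> (\<forall>x y a. g (x, y) = Some a \<longrightarrow> (t x, t y) \<in> r a))"

definition satisfiable :: "'a rel_alg \<Rightarrow> 'v set \<Rightarrow> ('v \<times> 'v \<rightharpoonup> 'a) \<Rightarrow> bool" where
  "satisfiable A V g \<longleftrightarrow> (\<exists>(B :: nat set) r. satisfied_in A B r V g)"

text \<open>As an input of the decision problem, a network has vertex set \<open>{0, \<dots>, n - 1}\<close> and is written
  as the \<open>n \<times> n\<close> matrix of its labels, row by row, over the alphabet consisting of the elements of
  the algebra and one further symbol \<open>None\<close> for pairs outside the domain of \<open>g\<close>.\<close>

definition alphabet :: "'a rel_alg \<Rightarrow> 'a option set" where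
  "alphabet A = insert None (Some ` carrier A)"

definition encode :: "nat \<Rightarrow> (nat \<times> nat \<rightharpoonup> 'a) \<Rightarrow> 'a option list" where
  "encode n g = [g (i, j). i \<leftarrow> [0..<n], j \<leftarrow> [0..<n]]"

definition NSP :: "'a rel_alg \<Rightarrow> 'a option list set" where
  "NSP A = {encode n g | n g. network A {0..<n} g \<and> satisfiable A {0..<n} g}"


section \<open>Polynomial-time many-one reductions\<close>

text \<open>Deterministic Turing machines with finitely many two-way infinite tapes. The machine halts
  when no transition applies; tape 0 holds the input and, at the end, the output.\<close>

datatype 'i symbol = Blank | Letter 'i | Work nat

datatype move = Go_Left | Stay | Go_Right

record 'i machine =
  num_tapes :: nat
  states :: "nat set"
  symbols :: "'i symbol set"
  start :: nat
  delta :: "nat \<Rightarrow> 'i symbol list \<Rightarrow> (nat \<times> ('i symbol \<times> move) list) option"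

definition wf_machine :: "'i machine \<Rightarrow> bool" where
  "wf_machine M \<longleftrightarrow>
     num_tapes M > 0 \<and> finite (states M) \<and> start M \<in> states M \<and>
     finite (symbols M) \<and> Blank \<in> symbols M \<and>
     (\<forall>q\<in>states M. \<forall>xs\<in>lists (symbols M). \<forall>q' acts.
        length xs = num_tapes M \<longrightarrow> delta M q xs = Some (q', acts) \<longrightarrow>
          q' \<in> states M \<and> length acts = num_tapes M \<and> fst ` set acts \<subseteq> symbols M)"

type_synonym 'i tape = "(int \<Rightarrow> 'i symbol) \<times> int"  \<comment> \<open>cell contents, head position\<close>
type_synonym 'i config = "nat \<times> 'i tape list"

fun read_tape :: "'i tape \<Rightarrow> 'i symbol" where
  "read_tape (c, h) = c h"

fun move_head :: "move \<Rightarrow> int \<Rightarrow> int" where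
  "move_head Go_Left h = h - 1"
| "move_head Stay h = h"
| "move_head Go_Right h = h + 1"

fun act_on_tape :: "'i symbol \<times> move \<Rightarrow> 'i tape \<Rightarrow> 'i tape" where
  "act_on_tape (s, m) (c, h) = (c(h := s), move_head m h)"

fun step :: "'i machine \<Rightarrow> 'i config \<Rightarrow> 'i config option" where
  "step M (q, ts) =
     (case delta M q (map read_tape ts) of
        None \<Rightarrow> None
      | Some (q', acts) \<Rightarrow> Some (q', map2 act_on_tape acts ts))"

definition word_cells :: "'i list \<Rightarrow> int \<Rightarrow> 'i symbol" where
  "word_cells w p = (if 0 \<le> p \<and> p < int (length w) then Letter (w ! nat p) else Blank)"

definition initial_config :: "'i machine \<Rightarrow> 'i list \<Rightarrow> 'i config" where
  "initial_config M w =
     (start M, (word_cells w, 0) # replicate (num_tapes M - 1) (word_cells [], 0))"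

definition halts_with :: "'i machine \<Rightarrow> 'i list \<Rightarrow> nat \<Rightarrow> 'i list \<Rightarrow> bool" where
  "halts_with M w t v \<longleftrightarrow>
     (\<exists>q ts. ((\<lambda>c c'. step M c = Some c') ^^ t) (initial_config M w) (q, ts) \<and>
        step M (q, ts) = None \<and> fst (hd ts) = word_cells v)"

definition polytime_computable :: "'i set \<Rightarrow> ('i list \<Rightarrow> 'i list) \<Rightarrow> bool" where
  "polytime_computable \<Sigma> f \<longleftrightarrow>
     (\<exists>M (p :: nat poly). wf_machine M \<and> Letter ` \<Sigma> \<subseteq> symbols M \<and>
        (\<forall>w\<in>lists \<Sigma>. \<exists>t \<le> poly p (length w). halts_with M w t (f w)))"

definition polytime_reducible ::
    "'i set \<Rightarrow> 'i list set \<Rightarrow> 'i set \<Rightarrow> 'i list set \<Rightarrow> bool" where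
  "polytime_reducible \<Sigma> L \<Sigma>' L' \<longleftrightarrow>
     (\<exists>f. polytime_computable \<Sigma> f \<and>
        (\<forall>w\<in>lists \<Sigma>. f w \<in> lists \<Sigma>' \<and> (w \<in> L \<longleftrightarrow> f w \<in> L')))"


section \<open>Atom structures and polymorphisms\<close>

text \<open>Relations are sets of tuples, written as lists and tagged with their arity. The names of the
  relations are immaterial for polymorphisms, so a structure carries just a set of relations.\<close>

record 'a rel_structure =
  struct_dom :: "'a set"
  struct_rels :: "(nat \<times> 'a list set) set"

definition atom_structure :: "'a rel_alg \<Rightarrow> 'a rel_structure" where
  "atom_structure A =
     \<lparr>struct_dom = atoms A,
      struct_rels =
        {(1, {[a] | a. a \<in> atoms A \<and> leq A a x}) | x. x \<in> carrier A} \<union>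
        {(2, {[a1, a2] | a1 a2. a1 \<in> atoms A \<and> a2 \<in> atoms A \<and> conv A a1 = a2})} \<union>
        {(3, {[a1, a2, a3] | a1 a2 a3. a1 \<in> atoms A \<and> a2 \<in> atoms A \<and> a3 \<in> atoms A \<and>
                leq A a3 (comp A a1 a2)})}\<rparr>"

text \<open>An \<open>n\<close>-ary operation is a function on lists, of which only the values on lists of length
  \<open>n\<close> over the domain matter; it is applied to \<open>n\<close> tuples coordinatewise.\<close>

definition polymorphism :: "nat \<Rightarrow> ('a list \<Rightarrow> 'a) \<Rightarrow> 'a rel_structure \<Rightarrow> bool" where
  "polymorphism n f S \<longleftrightarrow>
     (\<forall>xs\<in>lists (struct_dom S). length xs = n \<longrightarrow> f xs \<in> struct_dom S) \<and>
     (\<forall>(k, R)\<in>struct_rels S. \<forall>ts\<in>lists R. length ts = n \<longrightarrow>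
        map (\<lambda>i. f (map (\<lambda>t. t ! i) ts)) [0..<k] \<in> R)"

definition siggers_identity :: "('a list \<Rightarrow> 'a) \<Rightarrow> 'a set \<Rightarrow> bool" where
  "siggers_identity f D \<longleftrightarrow>
     (\<forall>x\<in>D. \<forall>y\<in>D. \<forall>z\<in>D. f [x, x, y, y, z, z] = f [y, z, x, z, x, y])"

definition has_siggers_polymorphism :: "'a rel_structure \<Rightarrow> bool" where
  "has_siggers_polymorphism S \<longleftrightarrow>
     (\<exists>f. polymorphism 6 f S \<and> siggers_identity f (struct_dom S))"


section \<open>Adequacy of representations on sets of natural numbers\<close>

lemma representation_iff:
  "representation A B r \<longleftrightarrow>
     closed_under_ops A (carrier A) \<and> equiv B (r (one A)) \<and> inj_on r (carrier A) \<and>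
     (\<forall>x\<in>carrier A. r x \<subseteq> r (one A)) \<and>
     r (zero A) = {} \<and> r (ident A) = Id_on B \<and>
     (\<forall>x\<in>carrier A. r (compl A x) = r (one A) - r x \<and> r (conv A x) = (r x)\<inverse>) \<and>
     (\<forall>x\<in>carrier A. \<forall>y\<in>carrier A.
        r (join A x y) = r x \<union> r y \<and> r (comp A x y) = r x O r y)"
  (is "?L \<longleftrightarrow> ?R")
proof
  assume ?L
  then obtain E X where *: "closed_under_ops A (carrier A)" "equiv B E" "X \<subseteq> Pow E"
    "rel_alg_iso r A ((full_rel_alg B E)\<lparr>carrier := X\<rparr>)"
    by (auto simp: representation_def proper_rel_alg_def full_rel_alg_def)
  then have iso: "bij_betw r (carrier A) X" "r (zero A) = {}" "r (one A) = E" "r (ident A) = Id_on B"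
      "\<forall>x\<in>carrier A. r (compl A x) = E - r x \<and> r (conv A x) = (r x)\<inverse>"
      "\<forall>x\<in>carrier A. \<forall>y\<in>carrier A.
         r (join A x y) = r x \<union> r y \<and> r (comp A x y) = r x O r y"
    unfolding rel_alg_iso_def full_rel_alg_def by simp_all
  have "\<forall>x\<in>carrier A. r x \<subseteq> E"
    using bij_betwE[OF iso(1)] \<open>X \<subseteq> Pow E\<close> by blast
  then show ?R
    using *(1,2) bij_betw_imp_inj_on[OF iso(1)] iso(2,4-6) unfolding iso(3) by (intro conjI)
next
  assume R: ?R
  then have cl: "closed_under_ops A (carrier A)" and E: "equiv B (r (one A))"
    and inj: "inj_on r (carrier A)" and sub: "\<And>x. x \<in> carrier A \<Longrightarrow> r x \<subseteq> r (one A)"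
    and const: "r (zero A) = {}" "r (ident A) = Id_on B"
    and unary: "\<And>x. x \<in> carrier A \<Longrightarrow> r (compl A x) = r (one A) - r x"
      "\<And>x. x \<in> carrier A \<Longrightarrow> r (conv A x) = (r x)\<inverse>"
    and binary: "\<And>x y. x \<in> carrier A \<Longrightarrow> y \<in> carrier A \<Longrightarrow> r (join A x y) = r x \<union> r y"
      "\<And>x y. x \<in> carrier A \<Longrightarrow> y \<in> carrier A \<Longrightarrow> r (comp A x y) = r x O r y"
    by simp_all
  let ?F = "full_rel_alg B (r (one A))"
  let ?P = "?F\<lparr>carrier := r ` carrier A\<rparr>"
  have iso: "rel_alg_iso r A ?P"
    unfolding rel_alg_iso_def full_rel_alg_def
    by (simp add: inj_on_imp_bij_betw[OF inj] const unary binary)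
  have "closed_under_ops ?F (r ` carrier A)"
    unfolding closed_under_ops_def ball_simps full_rel_alg_def rel_alg.simps
    by (simp add: const(1)[symmetric] const(2)[symmetric] unary[symmetric] binary[symmetric]
        cl[unfolded closed_under_ops_def])
  moreover have "r ` carrier A \<subseteq> carrier ?F"
    using sub unfolding full_rel_alg_def by (simp add: image_subset_iff)
  ultimately have "proper_rel_alg B ?P"
    using E unfolding proper_rel_alg_def by blast
  with iso show ?L using cl unfolding representation_def by blast
qed

lemma representation_countable:
  fixes B :: "'d set"
  assumes rep: "representation A B r" and fin: "countable (carrier A)"
    and S: "countable S" "S \<subseteq> B"
  obtains e :: "'d \<Rightarrow> nat" and B' r' where "representation A B' r'" "e ` S \<subseteq> B'"
    "\<And>a x y. x \<in> S \<Longrightarrow> y \<in> S \<Longrightarrow> (x, y) \<in> r a \<Longrightarrow> (e x, e y) \<in> r' a"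
proof -
  have R: "equiv B (r (one A))" "inj_on r (carrier A)" "\<And>x. x \<in> carrier A \<Longrightarrow> r x \<subseteq> r (one A)"
    and cl: "closed_under_ops A (carrier A)"
    and const: "r (zero A) = {}" "r (ident A) = Id_on B"
    and unary: "\<And>x. x \<in> carrier A \<Longrightarrow> r (compl A x) = r (one A) - r x"
      "\<And>x. x \<in> carrier A \<Longrightarrow> r (conv A x) = (r x)\<inverse>"
    and binary: "\<And>x y. x \<in> carrier A \<Longrightarrow> y \<in> carrier A \<Longrightarrow> r (join A x y) = r x \<union> r y"
      "\<And>x y. x \<in> carrier A \<Longrightarrow> y \<in> carrier A \<Longrightarrow> r (comp A x y) = r x O r y"
    using rep unfolding representation_iff by simp_all
  have EB: "r (one A) \<subseteq> B \<times> B" and E: "equiv B (r (one A))"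
    using R by (auto simp: equiv_def refl_on_def)
  have rB: "x \<in> B" "y \<in> B" if "(x, y) \<in> r a" "a \<in> carrier A" for a x y
    using R EB that by blast+
  define w where "w = (\<lambda>(a, b, x, z). SOME y. (x, y) \<in> r a \<and> (y, z) \<in> r b)"
  define F where
    "F X = X \<union> (w ` (carrier A \<times> carrier A \<times> X \<times> X) \<inter> B)" for X
  define d where "d = (\<lambda>(a, b). SOME p. p \<in> r a - r b)"
  define S0 where "S0 = S \<union> ((fst ` d ` (carrier A \<times> carrier A) \<union> snd ` d ` (carrier A \<times> carrier A)) \<inter> B)"
  define C where "C = (\<Union>n. (F ^^ n) S0)"
  have cn: "countable ((F ^^ n) S0)" for n
    by (induction n) (auto simp: F_def S0_def S fin intro!: countable_Int1 countable_SIGMA countable_image)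
  then have cC: "countable C" by (auto simp: C_def)
  have sn: "(F ^^ n) S0 \<subseteq> B" for n
    using S by (induction n) (auto simp: F_def S0_def)
  then have CB: "C \<subseteq> B" by (auto simp: C_def)
  have S0C: "S0 \<subseteq> C" unfolding C_def by (rule order_trans[OF _ UN_upper[of 0]]) auto
  have mono: "(F ^^ m) S0 \<subseteq> (F ^^ n) S0" if "m \<le> n" for m n
    using lift_Suc_mono_le[of "\<lambda>n. (F ^^ n) S0", OF _ that] by (auto simp: F_def)
  have wit: "\<exists>y\<in>C. (x, y) \<in> r a \<and> (y, z) \<in> r b"
    if h: "a \<in> carrier A" "b \<in> carrier A" "x \<in> C" "z \<in> C" "(x, z) \<in> r a O r b" for a b x z
  proof -
    obtain m n where "x \<in> (F ^^ m) S0" "z \<in> (F ^^ n) S0"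
      using h(3,4) unfolding C_def by blast
    then have xz: "x \<in> (F ^^ max m n) S0" "z \<in> (F ^^ max m n) S0"
      using mono[of m "max m n"] mono[of n "max m n"] by auto
    have y: "(x, w (a, b, x, z)) \<in> r a \<and> (w (a, b, x, z), z) \<in> r b"
      unfolding w_def prod.case by (rule someI_ex) (use that in blast)
    then have "w (a, b, x, z) \<in> B" using rB that by blast
    then have "w (a, b, x, z) \<in> F ((F ^^ max m n) S0)"
      using xz that by (auto simp: F_def)
    then have "w (a, b, x, z) \<in> (F ^^ Suc (max m n)) S0" by simp
    then have "w (a, b, x, z) \<in> C" unfolding C_def by blast
    with y show ?thesis by blast
  qed
  have sep: "\<exists>x\<in>C. \<exists>y\<in>C. (x, y) \<in> r a \<and> (x, y) \<notin> r b"
    if "a \<in> carrier A" "b \<in> carrier A" "\<not> r a \<subseteq> r b" for a b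
  proof -
    have p: "d (a, b) \<in> r a - r b"
      unfolding d_def prod.case by (rule someI_ex) (use that in blast)
    then have pB: "fst (d (a, b)) \<in> B" "snd (d (a, b)) \<in> B"
      using rB[of "fst (d (a, b))" "snd (d (a, b))" a] that by auto
    have "fst (d (a, b)) \<in> S0" "snd (d (a, b)) \<in> S0"
      unfolding S0_def using pB that by blast+
    with p S0C show ?thesis by (metis DiffD1 DiffD2 prod.collapse subsetD)
  qed
  define e where "e = to_nat_on C"
  have inj: "inj_on e C" unfolding e_def by (rule inj_on_to_nat_on[OF cC])
  define B' where "B' = e ` C"
  define r' where "r' a = {(e x, e y) | x y. x \<in> C \<and> y \<in> C \<and> (x, y) \<in> r a}" for a
  have r'_iff: "(e x, e y) \<in> r' a \<longleftrightarrow> (x, y) \<in> r a" if "x \<in> C" "y \<in> C" for x y a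
    using that inj by (auto simp: r'_def dest: inj_onD)
  have r'_sub: "r' a \<subseteq> B' \<times> B'" for a by (auto simp: r'_def B'_def)
  have r'_eqI: "U = V" if "U \<subseteq> B' \<times> B'" "V \<subseteq> B' \<times> B'"
    "\<And>x y. x \<in> C \<Longrightarrow> y \<in> C \<Longrightarrow> (e x, e y) \<in> U \<longleftrightarrow> (e x, e y) \<in> V" for U V
    using that unfolding B'_def by fast
  have eqC: "e x = e y \<longleftrightarrow> x = y" if "x \<in> C" "y \<in> C" for x y
    using that inj by (auto dest: inj_onD)
  have "representation A B' r'"
    unfolding representation_iff
  proof (intro conjI ballI)
    show "closed_under_ops A (carrier A)" by (rule cl)
    show "equiv B' (r' (one A))"
    proof (rule equivI)
      show "r' (one A) \<subseteq> B' \<times> B'" by (rule r'_sub)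
      show "refl_on B' (r' (one A))"
        using E CB r'_iff unfolding refl_on_def equiv_def B'_def by blast
      show "sym (r' (one A))"
        using E unfolding sym_def equiv_def r'_def by blast
      show "trans (r' (one A))"
      proof (rule transI)
        fix u v t assume "(u, v) \<in> r' (one A)" "(v, t) \<in> r' (one A)"
        then obtain x y y' z where *: "x \<in> C" "y \<in> C" "y' \<in> C" "z \<in> C"
          "u = e x" "v = e y" "v = e y'" "t = e z" "(x, y) \<in> r (one A)" "(y', z) \<in> r (one A)"
          unfolding r'_def by blast
        then have "y = y'" using eqC by auto
        with * have "(x, z) \<in> r (one A)" using E unfolding equiv_def trans_def by blast
        with * show "(u, t) \<in> r' (one A)" using r'_iff by blast
      qed
    qed
    show "inj_on r' (carrier A)"
    proof (rule inj_onI)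
      fix a b assume ab: "a \<in> carrier A" "b \<in> carrier A" "r' a = r' b"
      have "r a \<subseteq> r b" using sep[of a b] ab r'_iff by blast
      moreover have "r b \<subseteq> r a" using sep[of b a] ab r'_iff by blast
      ultimately show "a = b" using R ab by (auto dest: inj_onD)
    qed
    show "r' x \<subseteq> r' (one A)" if "x \<in> carrier A" for x
      using R that by (auto simp: r'_def)
    show "r' (zero A) = {}" using const by (auto simp: r'_def)
    show "r' (ident A) = Id_on B'"
    proof (rule r'_eqI)
      show "Id_on B' \<subseteq> B' \<times> B'" by auto
      show "(e x, e y) \<in> r' (ident A) \<longleftrightarrow> (e x, e y) \<in> Id_on B'" if "x \<in> C" "y \<in> C" for x y
        using that CB by (auto simp: r'_iff const Id_on_iff eqC B'_def)
    qed (rule r'_sub)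
    show "r' (compl A x) = r' (one A) - r' x" if "x \<in> carrier A" for x
    proof (rule r'_eqI)
      show "r' (one A) - r' x \<subseteq> B' \<times> B'" using r'_sub by blast
    qed (simp_all add: r'_sub r'_iff unary that)
    show "r' (conv A x) = (r' x)\<inverse>" if "x \<in> carrier A" for x
    proof (rule r'_eqI)
      show "(r' x)\<inverse> \<subseteq> B' \<times> B'" using r'_sub by blast
    qed (simp_all add: r'_sub r'_iff unary that)
    fix a b assume ab: "a \<in> carrier A" "b \<in> carrier A"
    show "r' (join A a b) = r' a \<union> r' b"
    proof (rule r'_eqI)
      show "r' a \<union> r' b \<subseteq> B' \<times> B'" using r'_sub by blast
    qed (simp_all add: r'_sub r'_iff binary ab)
    show "r' (comp A a b) = r' a O r' b"
    proof (rule r'_eqI)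
      show "r' a O r' b \<subseteq> B' \<times> B'" using r'_sub by blast
      fix x z assume xz: "x \<in> C" "z \<in> C"
      have "(e x, e z) \<in> r' (comp A a b) \<longleftrightarrow> (x, z) \<in> r a O r b"
        using r'_iff xz binary(2)[OF ab] by simp
      also have "\<dots> \<longleftrightarrow> (\<exists>y\<in>C. (x, y) \<in> r a \<and> (y, z) \<in> r b)"
        using wit[OF ab xz] by blast
      also have "\<dots> \<longleftrightarrow> (\<exists>y\<in>C. (e x, e y) \<in> r' a \<and> (e y, e z) \<in> r' b)"
        using r'_iff xz by auto
      also have "\<dots> \<longleftrightarrow> (e x, e z) \<in> r' a O r' b"
        using r'_sub unfolding B'_def by blast
      finally show "(e x, e z) \<in> r' (comp A a b) \<longleftrightarrow> (e x, e z) \<in> r' a O r' b" .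
    qed (rule r'_sub)
  qed
  moreover have SC: "S \<subseteq> C" using S0C by (auto simp: S0_def)
  then have "e ` S \<subseteq> B'" by (auto simp: B'_def)
  moreover have "(e x, e y) \<in> r' a" if "x \<in> S" "y \<in> S" "(x, y) \<in> r a" for a x y
    using that SC by (auto simp: r'_def)
  ultimately show thesis by (rule that)
qed

lemma representableI:
  fixes B :: "'d set"
  assumes "representation A B r" "countable (carrier A)"
  shows "representable A"
  unfolding representable_def by (rule representation_countable[OF assms, of "{}"]) auto

lemma satisfiableI:
  fixes B :: "'d set"
  assumes sat: "satisfied_in A B r V g" and net: "network A V g" and "countable (carrier A)"
  shows "satisfiable A V g"
proof -
  obtain t where rep: "representation A B r" and t: "t ` V \<subseteq> B"
    "\<And>x y a. g (x, y) = Some a \<Longrightarrow> (t x, t y) \<in> r a"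
    using sat unfolding satisfied_in_def by blast
  have "countable (t ` V)" using net by (auto simp: network_def intro: countable_finite)
  then show ?thesis
  proof (rule representation_countable[OF rep assms(3) _ t(1)])
    fix e :: "'d \<Rightarrow> nat" and B' r'
    assume *: "representation A B' r'" "e ` t ` V \<subseteq> B'"
      "\<And>a x y. x \<in> t ` V \<Longrightarrow> y \<in> t ` V \<Longrightarrow> (x, y) \<in> r a \<Longrightarrow> (e x, e y) \<in> r' a"
    have "x \<in> V \<and> y \<in> V" if "g (x, y) = Some a" for x y a
      using net that unfolding network_def by blast
    then have "\<forall>x y a. g (x, y) = Some a \<longrightarrow> ((e \<circ> t) x, (e \<circ> t) y) \<in> r' a"
      using * t(2) by simp
    then have "satisfied_in A B' r' V g"
      unfolding satisfied_in_def using *(1,2) unfolding image_comp by blast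
    then show "satisfiable A V g" unfolding satisfiable_def by blast
  qed
qed

end

theory Submission
  imports Defs
begin

text \<open>In every representation, flexibility of \<open>s\<close> forces all pairs of distinct related points into the
  part belonging to a single atom \<open>e \<le> Id\<close>, namely the one with \<open>s \<le> e \<circ> s\<close>. The points below the
  rest \<open>u = Id - e\<close> of the identity are therefore isolated, and \<open>A\<close> is the product of \<open>A'\<close>, the
  algebra of the elements disjoint from \<open>u\<close>, and the Boolean algebra below \<open>u\<close>.

  An \<open>A'\<close>-network is also an \<open>A\<close>-network with the same answer. For the other reduction,
  compute the greatest assignment \<open>P\<close> of elements below \<open>u\<close> to the vertices with \<open>P x = P y \<le> g (x, y)\<close>
  whenever \<open>g (x, y)\<close> is defined. Where \<open>P\<close> is nonzero the vertices can be sent to isolated points, so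
  these labels are dropped; all others are restricted to \<open>A'\<close>. Finding \<open>P\<close> by iteration avoids
  connected components, and soundness and completeness only need that \<open>P\<close> is a fixpoint that
  dominates every assignment coming from a solution.\<close>

section \<open>Turing machines\<close>

text \<open>Restricting every label to \<open>A'\<close> would be wrong, since a connected part of a
  network may be satisfiable only at an isolated point. Such a point is related to itself alone, so
  it takes all vertices of the part at once, and this works as soon as all labels of the part lie
  above one common atom below \<open>u\<close>. Different connected parts do not constrain each
  other, so nothing is lost by always preferring an isolated point when one is possible. This avoids
  any search and leaves to \<open>A'\<close> exactly the parts that must live inside
  \<open>e\<close>. Conversely, a solution of the reduced network may use a representation of
  \<open>A'\<close> that does not arise from one of \<open>A\<close>; it is repaired by adjoining
  one isolated point for each atom below \<open>u\<close>. The iteration suits a Turing machine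
  because an update looks at one matrix cell and two table entries and lowers a quantity that is
  linear in the number of vertices.\<close>

definition reach :: "'i machine \<Rightarrow> nat \<Rightarrow> 'i config \<Rightarrow> 'i config \<Rightarrow> bool" where
  "reach M t c c' \<longleftrightarrow> (\<exists>k\<le>t. ((\<lambda>c c'. step M c = Some c') ^^ k) c c')"

lemma reach_refl [simp]: "reach M t c c"
  unfolding reach_def by (rule exI[of _ 0]) auto

lemma reach_trans:
  assumes "reach M s c c'" "reach M t c' c''" "s + t \<le> b"
  shows "reach M b c c''"
proof -
  obtain k l where "k \<le> s" "l \<le> t" "((\<lambda>c c'. step M c = Some c') ^^ k) c c'"
    "((\<lambda>c c'. step M c = Some c') ^^ l) c' c''"
    using assms(1,2) unfolding reach_def by blast
  then have "((\<lambda>c c'. step M c = Some c') ^^ (k + l)) c c''" "k + l \<le> b"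
    using assms(3) by (auto simp: relpowp_add)
  then show ?thesis unfolding reach_def by blast
qed

lemma reach_step: "step M c = Some c' \<Longrightarrow> 0 < t \<Longrightarrow> reach M t c c'"
  unfolding reach_def by (rule exI[of _ 1]) auto

lemma reach_Suc: "step M c = Some c' \<Longrightarrow> reach M t c' c'' \<Longrightarrow> Suc t \<le> b \<Longrightarrow> reach M b c c''"
  by (rule reach_trans[of M 1 c c' t]) (auto intro: reach_step)

lemma reach_mono: "reach M s c c' \<Longrightarrow> s \<le> t \<Longrightarrow> reach M t c c'"
  unfolding reach_def by (meson le_trans)

lemma reach_iterate:
  assumes "\<And>i. i < k \<Longrightarrow> reach M t (c i) (c (Suc i))"
  shows "reach M (k * t) (c 0) (c k)"
  using assms
proof (induction k)
  case (Suc k)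
  then have "reach M (k * t) (c 0) (c k)" "reach M t (c k) (c (Suc k))" by auto
  then show ?case by (rule reach_trans) simp
qed simp

lemma word_cells_nth [simp]: "k < length xs \<Longrightarrow> word_cells xs (int k) = Letter (xs ! k)"
  by (simp add: word_cells_def)

lemma word_cells_Blank: "i < 0 \<or> int (length xs) \<le> i \<Longrightarrow> word_cells xs i = Blank"
  by (auto simp: word_cells_def)

lemma word_cells_eq_Blank: "word_cells xs i = Blank \<longleftrightarrow> i < 0 \<or> int (length xs) \<le> i"
  by (auto simp: word_cells_def)

lemma word_cells_update:
  "k < length xs \<Longrightarrow> (word_cells xs)(int k := Letter v) = word_cells (xs[k := v])"
  by (auto simp: word_cells_def nth_list_update fun_eq_iff)

lemma word_cells_append:
  "(word_cells xs)(int (length xs) := Letter v) = word_cells (xs @ [v])"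
  by (auto simp: word_cells_def nth_append fun_eq_iff)

lemma polytime_computable_id:
  assumes "finite \<Sigma>"
  shows "polytime_computable \<Sigma> (\<lambda>w. w)"
proof -
  define M :: "'a machine" where
    "M = \<lparr>num_tapes = 1, states = {0}, symbols = insert Blank (Letter ` \<Sigma>), start = 0,
           delta = (\<lambda>_ _. None)\<rparr>"
  have "wf_machine M" using assms by (simp add: wf_machine_def M_def)
  moreover have "Letter ` \<Sigma> \<subseteq> symbols M" by (auto simp: M_def)
  moreover have "halts_with M w 0 w" for w
    by (simp add: halts_with_def initial_config_def M_def)
  then have "\<exists>t\<le>poly 0 (length w). halts_with M w t w" for w by auto
  ultimately show ?thesis unfolding polytime_computable_def by blast
qed

section \<open>A three-tape machine iterating local updates over a square matrix\<close>

fun letter :: "'i symbol \<Rightarrow> 'i" where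
  "letter (Letter a) = a"

text \<open>A head that has reached a blank waits, so one state can rewind three heads that stand at
  different distances from the left end.\<close>

fun to_left :: "'i symbol \<Rightarrow> move" where
  "to_left Blank = Stay"
| "to_left _ = Go_Left"

text \<open>Reading \<open>upd c a b = Some v\<close> as the demand to replace both values \<open>a\<close> and \<open>b\<close> by \<open>v\<close>, the machine
  keeps two tables \<open>T1\<close>, \<open>T2\<close> with one value per vertex and performs demanded updates, for the pairs
  \<open>(T1 ! y, T2 ! x)\<close> at the matrix cell \<open>(x, y)\<close> and for the pairs \<open>(T1 ! k, T2 ! k)\<close> with the letter
  \<open>d\<close>, until none is left. Two copies of one table are needed because a tape has only one head.\<close>

locale grid_machine =
  fixes \<Sigma> :: "'i set" and d u rej :: 'i
    and upd :: "'i \<Rightarrow> 'i \<Rightarrow> 'i \<Rightarrow> 'i option" and out :: "'i \<Rightarrow> 'i \<Rightarrow> 'i" and \<mu> :: "'i \<Rightarrow> nat"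
  assumes finite_alphabet: "finite \<Sigma>" and mem: "d \<in> \<Sigma>" "u \<in> \<Sigma>" "rej \<in> \<Sigma>"
    and upd_mem: "\<And>c a b v. \<lbrakk>c \<in> \<Sigma>; a \<in> \<Sigma>; b \<in> \<Sigma>; upd c a b = Some v\<rbrakk> \<Longrightarrow> v \<in> \<Sigma>"
    and out_mem: "\<And>c b. \<lbrakk>c \<in> \<Sigma>; b \<in> \<Sigma>\<rbrakk> \<Longrightarrow> out c b \<in> \<Sigma>"
    and upd_less: "\<And>c a b v. \<lbrakk>c \<in> \<Sigma>; a \<in> \<Sigma>; b \<in> \<Sigma>; upd c a b = Some v\<rbrakk> \<Longrightarrow> 2 * \<mu> v < \<mu> a + \<mu> b"
begin

text \<open>States 0 to 2 build the two tables; each round from \<open>m\<close> to \<open>m + 1\<close> entries consumes \<open>2 * m + 1\<close>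
  input cells, so that a square length \<open>n * n\<close> is exhausted exactly when the tables have \<open>n\<close> entries.
  State 4 compares the tables, state 6 scans the matrix, and any update restarts with state 4. State
  8 writes the output. States 3, 5 and 7 rewind all heads, states 9 and 10 only that of \<open>T1\<close> at the
  end of a row. State 11 overwrites an input of non-square length.\<close>

definition tr :: "nat \<Rightarrow> 'i symbol \<Rightarrow> 'i symbol \<Rightarrow> 'i symbol \<Rightarrow> (nat \<times> ('i symbol \<times> move) list) option"
  where "tr q c a b =
    (if q = 0 then
       if c = Blank then Some (3, [(c, Go_Left), (a, Go_Left), (b, Go_Left)])
       else Some (1, [(c, Stay), (a, Stay), (b, Stay)])
     else if q = 1 then
       if c = Blank then Some (11, [(c, Go_Left), (a, Stay), (b, Stay)])
       else if a = Blank then Some (2, [(c, Go_Right), (Letter u, Go_Left), (Letter u, Go_Right)])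
       else Some (1, [(c, Go_Right), (a, Go_Right), (b, Stay)])
     else if q = 2 then
       if a = Blank then Some (0, [(c, Stay), (a, Go_Right), (b, Stay)])
       else if c = Blank then Some (11, [(c, Go_Left), (a, Stay), (b, Stay)])
       else Some (2, [(c, Go_Right), (a, Go_Left), (b, Stay)])
     else if q \<in> {3, 5, 7} then
       if c = Blank \<and> a = Blank \<and> b = Blank
       then Some (Suc q, [(c, Go_Right), (a, Go_Right), (b, Go_Right)])
       else Some (q, [(c, to_left c), (a, to_left a), (b, to_left b)])
     else if q = 4 then
       if a = Blank \<or> b = Blank then Some (5, [(c, Go_Left), (a, Go_Left), (b, Go_Left)])
       else case upd d (letter a) (letter b) of
           None \<Rightarrow> Some (4, [(c, Stay), (a, Go_Right), (b, Go_Right)])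
         | Some v \<Rightarrow> Some (3, [(c, Go_Left), (Letter v, Go_Left), (Letter v, Go_Left)])
     else if q = 6 then
       if c = Blank then Some (7, [(c, Go_Left), (a, Go_Left), (b, Go_Left)])
       else if a = Blank \<or> b = Blank then Some (9, [(c, Stay), (a, Go_Left), (b, Stay)])
       else case upd (letter c) (letter a) (letter b) of
           None \<Rightarrow> Some (6, [(c, Go_Right), (a, Go_Right), (b, Stay)])
         | Some v \<Rightarrow> Some (3, [(c, Go_Left), (Letter v, Go_Left), (Letter v, Go_Left)])
     else if q = 8 then
       if c = Blank then None
       else if a = Blank \<or> b = Blank then Some (10, [(c, Stay), (a, Go_Left), (b, Stay)])
       else Some (8, [(Letter (out (letter c) (letter b)), Go_Right), (a, Go_Right), (b, Stay)])
     else if q \<in> {9, 10} then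
       if a = Blank then Some (if q = 9 then 6 else 8, [(c, Stay), (a, Go_Right), (b, Go_Right)])
       else Some (q, [(c, Stay), (a, Go_Left), (b, Stay)])
     else if c = Blank then None
     else Some (11, [(Letter rej, Go_Left), (a, Stay), (b, Stay)]))"

definition M :: "'i machine" where
  "M = \<lparr>num_tapes = 3, states = {..11}, symbols = insert Blank (Letter ` \<Sigma>), start = 0,
         delta = (\<lambda>q cs. tr q (cs ! 0) (cs ! 1) (cs ! 2))\<rparr>"

lemma tr_simps:
  "tr 0 c a b =
     (if c = Blank then Some (3, [(c, Go_Left), (a, Go_Left), (b, Go_Left)])
      else Some (1, [(c, Stay), (a, Stay), (b, Stay)]))"
  "tr 1 c a b =
     (if c = Blank then Some (11, [(c, Go_Left), (a, Stay), (b, Stay)])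
      else if a = Blank then Some (2, [(c, Go_Right), (Letter u, Go_Left), (Letter u, Go_Right)])
      else Some (1, [(c, Go_Right), (a, Go_Right), (b, Stay)]))"
  "tr 2 c a b =
     (if a = Blank then Some (0, [(c, Stay), (a, Go_Right), (b, Stay)])
      else if c = Blank then Some (11, [(c, Go_Left), (a, Stay), (b, Stay)])
      else Some (2, [(c, Go_Right), (a, Go_Left), (b, Stay)]))"
  "tr 4 c a b =
     (if a = Blank \<or> b = Blank then Some (5, [(c, Go_Left), (a, Go_Left), (b, Go_Left)])
      else case upd d (letter a) (letter b) of
          None \<Rightarrow> Some (4, [(c, Stay), (a, Go_Right), (b, Go_Right)])
        | Some v \<Rightarrow> Some (3, [(c, Go_Left), (Letter v, Go_Left), (Letter v, Go_Left)]))"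
  "tr 6 c a b =
     (if c = Blank then Some (7, [(c, Go_Left), (a, Go_Left), (b, Go_Left)])
      else if a = Blank \<or> b = Blank then Some (9, [(c, Stay), (a, Go_Left), (b, Stay)])
      else case upd (letter c) (letter a) (letter b) of
          None \<Rightarrow> Some (6, [(c, Go_Right), (a, Go_Right), (b, Stay)])
        | Some v \<Rightarrow> Some (3, [(c, Go_Left), (Letter v, Go_Left), (Letter v, Go_Left)]))"
  "tr 8 c a b =
     (if c = Blank then None
      else if a = Blank \<or> b = Blank then Some (10, [(c, Stay), (a, Go_Left), (b, Stay)])
      else Some (8, [(Letter (out (letter c) (letter b)), Go_Right), (a, Go_Right), (b, Stay)]))"
  "tr 9 c a b =
     (if a = Blank then Some (6, [(c, Stay), (a, Go_Right), (b, Go_Right)])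
      else Some (9, [(c, Stay), (a, Go_Left), (b, Stay)]))"
  "tr 10 c a b =
     (if a = Blank then Some (8, [(c, Stay), (a, Go_Right), (b, Go_Right)])
      else Some (10, [(c, Stay), (a, Go_Left), (b, Stay)]))"
  "tr 11 c a b =
     (if c = Blank then None else Some (11, [(Letter rej, Go_Left), (a, Stay), (b, Stay)]))"
  unfolding tr_def by simp_all

lemma tr_rewind:
  assumes "q \<in> {3, 5, 7}"
  shows "tr q c a b =
     (if c = Blank \<and> a = Blank \<and> b = Blank
      then Some (Suc q, [(c, Go_Right), (a, Go_Right), (b, Go_Right)])
      else Some (q, [(c, to_left c), (a, to_left a), (b, to_left b)]))"
proof -
  have "q \<noteq> 0" "q \<noteq> 1" "q \<noteq> 2" using assms by auto
  then show ?thesis using assms unfolding tr_def by (simp only: if_False if_True)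
qed

lemma tr_wf:
  assumes "q \<le> 11" "c \<in> insert Blank (Letter ` \<Sigma>)" "a \<in> insert Blank (Letter ` \<Sigma>)"
    "b \<in> insert Blank (Letter ` \<Sigma>)" "tr q c a b = Some (q', acts)"
  shows "q' \<le> 11 \<and> length acts = 3 \<and> fst ` set acts \<subseteq> insert Blank (Letter ` \<Sigma>)"
proof -
  have sym: "letter x \<in> \<Sigma>" if "x \<in> insert Blank (Letter ` \<Sigma>)" "x \<noteq> Blank" for x
    using that by auto
  consider "q = 0" | "q = 1" | "q = 2" | "q \<in> {3, 5, 7}" | "q = 4" | "q = 6" | "q = 8" | "q = 9"
    | "q = 10" | "q = 11"
  proof -
    have "q = 0 \<or> q = 1 \<or> q = 2 \<or> q = 3 \<or> q = 4 \<or> q = 5 \<or> q = 6 \<or> q = 7 \<or> q = 8 \<or> q = 9 \<or>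
      q = 10 \<or> q = 11"
      using assms(1) by presburger
    then show thesis using that by blast
  qed
  then show ?thesis
  proof cases
    case 4
    then show ?thesis using assms(2-5) by (auto simp only: tr_rewind split: if_splits) auto
  next
    case 5
    have "v \<in> \<Sigma>" if "upd d (letter a) (letter b) = Some v" "a \<noteq> Blank" "b \<noteq> Blank" for v
      using upd_mem[OF mem(1) sym[OF assms(3)] sym[OF assms(4)]] that by simp
    then show ?thesis using assms(2-5) 5
      by (simp only: tr_simps split: if_splits option.splits) auto
  next
    case 6
    have "v \<in> \<Sigma>" if "upd (letter c) (letter a) (letter b) = Some v" "c \<noteq> Blank" "a \<noteq> Blank" "b \<noteq> Blank"
      for v
      using upd_mem[OF sym[OF assms(2)] sym[OF assms(3)] sym[OF assms(4)]] that by simp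
    then show ?thesis using assms(2-5) 6
      by (simp only: tr_simps split: if_splits option.splits) auto
  next
    case 7
    have "out (letter c) (letter b) \<in> \<Sigma>" if "c \<noteq> Blank" "b \<noteq> Blank"
      using out_mem[OF sym[OF assms(2)] sym[OF assms(4)]] that by simp
    then show ?thesis using assms(2-5) 7
      by (simp only: tr_simps split: if_splits) auto
  qed (use assms(2-5) mem in \<open>(simp only: tr_simps split: if_splits; auto)\<close>)+
qed

lemma wf_M: "wf_machine M"
proof -
  have "q' \<le> 11 \<and> length acts = 3 \<and> fst ` set acts \<subseteq> insert Blank (Letter ` \<Sigma>)"
    if "q \<le> 11" "xs \<in> lists (insert Blank (Letter ` \<Sigma>))" "length xs = 3"
      "tr q (xs ! 0) (xs ! 1) (xs ! 2) = Some (q', acts)" for q xs q' acts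
  proof -
    have "xs ! i \<in> insert Blank (Letter ` \<Sigma>)" if "i < 3" for i
      using that \<open>xs \<in> _\<close> \<open>length xs = 3\<close> by (metis in_listsD nth_mem)
    then show ?thesis using tr_wf[OF that(1) _ _ _ that(4)] by simp
  qed
  then show ?thesis using finite_alphabet unfolding wf_machine_def M_def by auto
qed

section \<open>Rewinding and row-by-row sweeps\<close>

definition cfg :: "nat \<Rightarrow> 'i list \<Rightarrow> int \<Rightarrow> 'i list \<Rightarrow> int \<Rightarrow> 'i list \<Rightarrow> int \<Rightarrow> 'i config" where
  "cfg q xs i ys j zs k = (q, [(word_cells xs, i), (word_cells ys, j), (word_cells zs, k)])"

lemma step_cfg:
  "step M (cfg q xs i ys j zs k) =
     (case tr q (word_cells xs i) (word_cells ys j) (word_cells zs k) of None \<Rightarrow> None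
      | Some (q', acts) \<Rightarrow>
          Some (q', map2 act_on_tape acts [(word_cells xs, i), (word_cells ys, j), (word_cells zs, k)]))"
  by (simp add: cfg_def M_def)

lemmas step_simps = step_cfg tr_simps tr_simps(2)[unfolded One_nat_def] tr_rewind word_cells_Blank fun_upd_idem

lemma initial_cfg: "initial_config M w = cfg 0 w 0 [] 0 [] 0"
  by (simp add: initial_config_def M_def cfg_def numeral_2_eq_2)

lemma to_left_eq: "to_left c = (if c = Blank then Stay else Go_Left)"
  by (cases c) auto

text \<open>No head starts to the right of its word, so a blank under a head means that it stands at
  \<open>-1\<close>. Once all three read a blank, they step together to cell \<open>0\<close>. The
  bound adds the three distances although the heads move simultaneously.\<close>

lemma rewind:
  assumes "q \<in> {3, 5, 7}" "-1 \<le> i" "i < int (length xs)" "-1 \<le> j" "j < int (length ys)"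
    "-1 \<le> k" "k < int (length zs)"
  shows "reach M (nat (i + j + k + 4)) (cfg q xs i ys j zs k) (cfg (Suc q) xs 0 ys 0 zs 0)"
  using assms(2-)
proof (induction "nat (i + j + k + 3)" arbitrary: i j k rule: less_induct)
  case less
  show ?case
  proof (cases "i = -1 \<and> j = -1 \<and> k = -1")
    case True
    then show ?thesis using assms(1)
      by (intro reach_step) (auto simp: step_simps, auto simp: cfg_def)
  next
    case False
    let ?b = "\<lambda>i. if i = -1 then i else i - 1"
    have "step M (cfg q xs i ys j zs k) = Some (cfg q xs (?b i) ys (?b j) zs (?b k))"
      using False assms(1) less.prems
      by (auto simp: step_simps word_cells_eq_Blank to_left_eq, auto simp: cfg_def)
    moreover have "reach M (nat (?b i + ?b j + ?b k + 4)) (cfg q xs (?b i) ys (?b j) zs (?b k))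
        (cfg (Suc q) xs 0 ys 0 zs 0)"
      using False less.prems by (intro less.hyps) auto
    ultimately show ?thesis
      by (rule reach_Suc) (use False less.prems in auto)
  qed
qed

lemma row_rewind:
  assumes "q = 6 \<and> q' = 9 \<or> q = 8 \<and> q' = 10" "-1 \<le> j" "j < int (length ys)"
  shows "reach M (nat (j + 2)) (cfg q' xs i ys j zs k) (cfg q xs i ys 0 zs (k + 1))"
  using assms(2-)
proof (induction "nat (j + 1)" arbitrary: j rule: less_induct)
  case less
  show ?case
  proof (cases "j = -1")
    case True
    then show ?thesis using assms(1)
      by (intro reach_step) (auto simp: step_simps, auto simp: cfg_def)
  next
    case False
    have "step M (cfg q' xs i ys j zs k) = Some (cfg q' xs i ys (j - 1) zs k)"
      using False assms(1) less.prems
      by (auto simp: step_simps word_cells_eq_Blank, auto simp: cfg_def)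
    moreover have "reach M (nat (j - 1 + 2)) (cfg q' xs i ys (j - 1) zs k) (cfg q xs i ys 0 zs (k + 1))"
      using False less.prems by (intro less.hyps) auto
    ultimately show ?thesis
      by (rule reach_Suc) (use False less.prems in auto)
  qed
qed

text \<open>Shared by the search for updates and by the output, which rewrites tape 0 on the way:
  \<open>W p\<close> is the content of tape 0 after \<open>p\<close> cells. The bound
  \<open>b\<close> lets a sweep stop at the first cell that demands an update. A full row costs
  \<open>n\<close> steps for its cells, one for the turn and \<open>n + 1\<close> for the return of
  the \<open>T1\<close> head.\<close>

lemma sweep:
  fixes q q' :: nat
  assumes q: "q = 6 \<and> q' = 9 \<or> q = 8 \<and> q' = 10"
    and len: "length T1 = n" "length T2 = n" "\<And>p. length (W p) = n * n"
    and step: "\<And>x y. \<lbrakk>x < n; y < n; x * n + y < b\<rbrakk> \<Longrightarrow>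
      step M (cfg q (W (x * n + y)) (int (x * n + y)) T1 (int y) T2 (int x)) =
        Some (cfg q (W (Suc (x * n + y))) (int (Suc (x * n + y))) T1 (int (Suc y)) T2 (int x))"
    and "x < n" "y \<le> n" "x * n + y \<le> b"
  shows "reach M (x * (2 * n + 3) + y) (cfg q (W 0) 0 T1 0 T2 0)
      (cfg q (W (x * n + y)) (int (x * n + y)) T1 (int y) T2 (int x))"
proof -
  let ?c = "\<lambda>x y. cfg q (W (x * n + y)) (int (x * n + y)) T1 (int y) T2 (int x)"
  have row: "reach M y (?c x 0) (?c x y)" if "x < n" "y \<le> n" "x * n + y \<le> b" for x y
  proof -
    have "reach M (y * 1) (?c x 0) (?c x y)"
      by (rule reach_iterate[where c = "?c x"], rule reach_step) (use step that in simp_all)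
    then show ?thesis by simp
  qed
  show ?thesis using assms(6-)
  proof (induction x arbitrary: y)
    case 0
    then show ?case using row[of 0 y] by simp
  next
    case (Suc x)
    let ?w = "W (x * n + n)" and ?i = "int (x * n + n)"
    \<comment> \<open>A row other than the last ends on a nonblank input cell; this is how the
      machine tells the end of a row from the end of the matrix.\<close>
    have "x * n + n < n * n" using mult_le_mono1[of "Suc (Suc x)" n n] Suc.prems by simp
    then have "?i < int (length ?w)" by (simp add: len del: of_nat_add of_nat_mult)
    then have "step M (?c x n) = Some (cfg q' ?w ?i T1 (int n - 1) T2 (int x))"
      using q len(1) by (auto simp: step_simps word_cells_eq_Blank simp del: of_nat_add of_nat_mult)
        (auto simp: cfg_def)
    moreover have "reach M (n + 1) (cfg q' ?w ?i T1 (int n - 1) T2 (int x)) (cfg q ?w ?i T1 0 T2 (int x + 1))"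
      using row_rewind[OF q, of "int n - 1" T1] len by (simp add: nat_add_distrib)
    ultimately have "reach M (n + 2) (?c x n) (cfg q ?w ?i T1 0 T2 (int x + 1))"
      by (rule reach_Suc) simp
    moreover have "reach M (x * (2 * n + 3) + n) (cfg q (W 0) 0 T1 0 T2 0) (?c x n)"
      using Suc.prems by (intro Suc.IH) auto
    moreover have "cfg q ?w ?i T1 0 T2 (int x + 1) = ?c (Suc x) 0"
      by (simp add: algebra_simps)
    ultimately have "reach M (x * (2 * n + 3) + n + (n + 2)) (cfg q (W 0) 0 T1 0 T2 0) (?c (Suc x) 0)"
      using reach_trans by fastforce
    from reach_trans[OF this row[OF Suc.prems]] show ?case
      by (simp add: algebra_simps)
  qed
qed

text \<open>The order of updates is left open, so correctness of the reduction is independent of the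
  schedule of the machine. A matrix cell touches one entry in each copy of the table; the diagonal
  rule carries a change over to the other copy.\<close>

inductive change :: "'i list \<Rightarrow> nat \<Rightarrow> 'i list \<times> 'i list \<Rightarrow> 'i list \<times> 'i list \<Rightarrow> bool" for w n where
  diagonal: "\<lbrakk>k < n; upd d (T1 ! k) (T2 ! k) = Some v\<rbrakk> \<Longrightarrow>
    change w n (T1, T2) (T1[k := v], T2[k := v])"
| cell: "\<lbrakk>x < n; y < n; upd (w ! (x * n + y)) (T1 ! y) (T2 ! x) = Some v\<rbrakk> \<Longrightarrow>
    change w n (T1, T2) (T1[y := v], T2[x := v])"

definition stable :: "'i list \<Rightarrow> nat \<Rightarrow> 'i list \<Rightarrow> 'i list \<Rightarrow> bool" where
  "stable w n T1 T2 \<longleftrightarrow> (\<forall>k<n. upd d (T1 ! k) (T2 ! k) = None) \<and>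
     (\<forall>x<n. \<forall>y<n. upd (w ! (x * n + y)) (T1 ! y) (T2 ! x) = None)"

section \<open>Passes over the matrix until no update is demanded\<close>

lemma merge:
  assumes "length T1 = n" "length T2 = n" "k \<le> n" "\<forall>i<k. upd d (T1 ! i) (T2 ! i) = None"
  shows "reach M k (cfg 4 w 0 T1 0 T2 0) (cfg 4 w 0 T1 (int k) T2 (int k))"
proof -
  let ?c = "\<lambda>i. cfg 4 w 0 T1 (int i) T2 (int i)"
  have "reach M 1 (?c i) (?c (Suc i))" if "i < k" for i
  proof (rule reach_step)
    have "upd d (T1 ! i) (T2 ! i) = None" "i < length T1" "i < length T2" using assms that by auto
    then show "step M (?c i) = Some (?c (Suc i))"
      by (simp add: step_simps) (simp add: cfg_def fun_upd_idem)
  qed simp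
  from reach_iterate[where c = ?c, OF this] show ?thesis by simp
qed

lemma scan:
  assumes len: "length T1 = n" "length T2 = n" "length w = n * n"
    and none: "\<And>x y. \<lbrakk>x < n; y < n; x * n + y < b\<rbrakk> \<Longrightarrow> upd (w ! (x * n + y)) (T1 ! y) (T2 ! x) = None"
    and "x < n" "y \<le> n" "x * n + y \<le> b"
  shows "reach M (x * (2 * n + 3) + y) (cfg 6 w 0 T1 0 T2 0)
    (cfg 6 w (int (x * n + y)) T1 (int y) T2 (int x))"
proof (rule sweep[where W = "\<lambda>_. w" and b = b])
  fix x y assume xy: "x < n" "y < n" "x * n + y < b"
  have "x * n + y < n * n" using mult_le_mono1[of "Suc x" n n] xy by simp
  then have "word_cells w (int (x * n + y)) = Letter (w ! (x * n + y))"
    by (intro word_cells_nth) (simp add: len)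
  then show "step M (cfg 6 w (int (x * n + y)) T1 (int y) T2 (int x)) =
    Some (cfg 6 w (int (Suc (x * n + y))) T1 (int (Suc y)) T2 (int x))"
    using xy len none[OF xy] by (simp add: step_simps del: of_nat_add of_nat_mult, simp add: cfg_def)
qed (use assms in auto)

text \<open>In a pass without update, comparing the tables and rewinding takes at most
  \<open>3 * n + 2\<close> steps, the scan \<open>2 * (n * n) + 4 * n\<close> and the final rewind
  \<open>n * n + 2 * n + 2\<close>. The constant term is generous.\<close>

definition pass_time :: "nat \<Rightarrow> nat" where
  "pass_time n = 3 * (n * n) + 9 * n + 20"

lemma pass:
  assumes len: "length T1 = n" "length T2 = n" "length w = n * n"
  shows "(\<exists>S1 S2. change w n (T1, T2) (S1, S2) \<and>
      reach M (pass_time n) (cfg 4 w 0 T1 0 T2 0) (cfg 4 w 0 S1 0 S2 0)) \<or>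
    stable w n T1 T2 \<and> reach M (pass_time n) (cfg 4 w 0 T1 0 T2 0) (cfg 8 w 0 T1 0 T2 0)"
proof -
  let ?start = "cfg 4 w 0 T1 0 T2 0"
  show ?thesis
  proof (cases "\<exists>k<n. upd d (T1 ! k) (T2 ! k) \<noteq> None")
    case True
    \<comment> \<open>The machine acts on the first demanded update, so the least index is taken: no
      earlier one interrupts the run.\<close>
    define k where "k = (LEAST k. k < n \<and> upd d (T1 ! k) (T2 ! k) \<noteq> None)"
    have k: "k < n \<and> upd d (T1 ! k) (T2 ! k) \<noteq> None"
      using LeastI_ex[OF True] unfolding k_def .
    then obtain v where v: "upd d (T1 ! k) (T2 ! k) = Some v" by auto
    have "\<forall>i<k. upd d (T1 ! i) (T2 ! i) = None"
      using k not_less_Least[of _ "\<lambda>k. k < n \<and> upd d (T1 ! k) (T2 ! k) \<noteq> None"]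
      unfolding k_def[symmetric] by (meson less_trans)
    then have 1: "reach M k ?start (cfg 4 w 0 T1 (int k) T2 (int k))"
      using k by (intro merge[OF len(1,2)]) auto
    have 2: "step M (cfg 4 w 0 T1 (int k) T2 (int k)) =
        Some (cfg 3 w (-1) (T1[k := v]) (int k - 1) (T2[k := v]) (int k - 1))"
      using k v len by (simp add: step_simps word_cells_update, simp add: cfg_def word_cells_update)
    have 3: "reach M (2 * k + 1) (cfg 3 w (-1) (T1[k := v]) (int k - 1) (T2[k := v]) (int k - 1))
        (cfg 4 w 0 (T1[k := v]) 0 (T2[k := v]) 0)"
      using rewind[of 3 "-1" w "int k - 1" "T1[k := v]" "int k - 1" "T2[k := v]"] len(1,2) k
      by (auto elim!: reach_mono)
    have "reach M (pass_time n) ?start (cfg 4 w 0 (T1[k := v]) 0 (T2[k := v]) 0)"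
      by (rule reach_trans[OF 1 reach_Suc[OF 2 3 order_refl]]) (use k in \<open>simp add: pass_time_def\<close>)
    moreover have "change w n (T1, T2) (T1[k := v], T2[k := v])"
      using k v by (intro diagonal) auto
    ultimately show ?thesis by blast
  next
    case False
    then have 1: "reach M n ?start (cfg 4 w 0 T1 (int n) T2 (int n))"
      by (intro merge[OF len(1,2)]) auto
    have 2: "step M (cfg 4 w 0 T1 (int n) T2 (int n)) =
        Some (cfg 5 w (-1) T1 (int n - 1) T2 (int n - 1))"
      using len by (simp add: step_simps, simp add: cfg_def fun_upd_idem)
    have 3: "reach M (2 * n + 1) (cfg 5 w (-1) T1 (int n - 1) T2 (int n - 1)) (cfg 6 w 0 T1 0 T2 0)"
      using rewind[of 5 "-1" w "int n - 1" T1 "int n - 1" T2] len(1,2)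
      by (auto elim!: reach_mono)
    have mid: "reach M (3 * n + 2) ?start (cfg 6 w 0 T1 0 T2 0)"
      by (rule reach_trans[OF 1 reach_Suc[OF 2 3 order_refl]]) simp
    let ?bad = "\<lambda>p. \<exists>x<n. \<exists>y<n. p = x * n + y \<and> upd (w ! p) (T1 ! y) (T2 ! x) \<noteq> None"
    show ?thesis
    proof (cases "\<exists>p. ?bad p")
      case True
      define p where "p = (LEAST p. ?bad p)"
      have "?bad p" using LeastI_ex[OF True] unfolding p_def .
      then obtain x y v where xy: "x < n" "y < n" "p = x * n + y"
        "upd (w ! p) (T1 ! y) (T2 ! x) = Some v" by blast
      have none: "upd (w ! (x * n + y)) (T1 ! y) (T2 ! x) = None"
        if "x < n" "y < n" "x * n + y < p" for x y
        using not_less_Least[of "x * n + y" ?bad] that unfolding p_def by blast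
      have 1: "reach M (x * (2 * n + 3) + y) (cfg 6 w 0 T1 0 T2 0)
          (cfg 6 w (int p) T1 (int y) T2 (int x))"
        using scan[OF len none xy(1)] xy by simp
      have p: "p < n * n" using mult_le_mono1[of "Suc x" n n] xy by simp
      then have pl: "p < length w" using len by simp
      have 2: "step M (cfg 6 w (int p) T1 (int y) T2 (int x)) =
        Some (cfg 3 w (int p - 1) (T1[y := v]) (int y - 1) (T2[x := v]) (int x - 1))"
        using pl xy(1,2,4) len(1,2)
        by (simp add: step_simps word_cells_update, simp add: cfg_def fun_upd_idem word_cells_update)
      have 3: "reach M (p + y + x + 1)
          (cfg 3 w (int p - 1) (T1[y := v]) (int y - 1) (T2[x := v]) (int x - 1))
          (cfg 4 w 0 (T1[y := v]) 0 (T2[x := v]) 0)"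
        using rewind[of 3 "int p - 1" w "int y - 1" "T1[y := v]" "int x - 1" "T2[x := v]"] len(1,2) pl xy(1,2)
        by (auto elim!: reach_mono)
      have "x * (2 * n + 3) \<le> 2 * (n * n) + 3 * n"
        using mult_le_mono1[of x n "2 * n + 3"] xy(1) by (simp add: algebra_simps)
      then have "reach M (pass_time n) ?start (cfg 4 w 0 (T1[y := v]) 0 (T2[x := v]) 0)"
        by (intro reach_trans[OF mid reach_trans[OF 1 reach_Suc[OF 2 3 order_refl] order_refl]])
          (use xy(1,2) p in \<open>simp add: pass_time_def\<close>)
      moreover have "change w n (T1, T2) (T1[y := v], T2[x := v])"
        using xy by (intro cell) auto
      ultimately show ?thesis by blast
    next
      case none: False
      then have "stable w n T1 T2" using False unfolding stable_def by blast
      \<comment> \<open>The scan ends without leaving the last row, hence the row index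
        \<open>n - 1\<close>; for \<open>n = 0\<close> truncated subtraction gives the start
        cell.\<close>
      moreover have "reach M (2 * (n * n) + 4 * n) (cfg 6 w 0 T1 0 T2 0)
          (cfg 6 w (int (n * n)) T1 (int (if n = 0 then 0 else n)) T2 (int (n - 1)))"
      proof (cases n)
        case (Suc m)
        have "reach M (m * (2 * n + 3) + n) (cfg 6 w 0 T1 0 T2 0)
          (cfg 6 w (int (m * n + n)) T1 (int n) T2 (int m))"
          by (rule scan[OF len, where b = "n * n"]) (use none Suc in auto)
        then show ?thesis using Suc by (auto elim!: reach_mono simp: algebra_simps)
      qed simp
      moreover have "step M (cfg 6 w (int (n * n)) T1 (int (if n = 0 then 0 else n)) T2 (int (n - 1))) =
          Some (cfg 7 w (int (n * n) - 1) T1 (int n - 1) T2 (int (n - 1) - 1))"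
        using len by (simp add: step_simps del: of_nat_mult, simp add: cfg_def)
      moreover have "reach M (n * n + 2 * n + 1)
          (cfg 7 w (int (n * n) - 1) T1 (int n - 1) T2 (int (n - 1) - 1)) (cfg 8 w 0 T1 0 T2 0)"
      proof (rule reach_mono[OF rewind[of 7, simplified]])
        have "int (n - 1) \<le> int n" by simp
        then show "nat (int (n * n) - 1 + (int n - 1) + (int (n - 1) - 1) + 4) \<le> n * n + 2 * n + 1"
          by linarith
      qed (use len in \<open>auto simp: algebra_simps\<close>)
      ultimately show ?thesis
        by (intro disjI2 conjI reach_trans[OF mid reach_trans[OF _ reach_Suc[OF _ _ order_refl] order_refl]])
          (assumption | simp add: pass_time_def)+
    qed
  qed
qed

lemma change_props:
  assumes "change w n (T1, T2) (S1, S2)" "set w \<subseteq> \<Sigma>" "length w = n * n"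
    "length T1 = n" "length T2 = n" "set T1 \<subseteq> \<Sigma>" "set T2 \<subseteq> \<Sigma>"
  shows "length S1 = n" "length S2 = n" "set S1 \<subseteq> \<Sigma>" "set S2 \<subseteq> \<Sigma>"
    "sum_list (map \<mu> S1) + sum_list (map \<mu> S2) < sum_list (map \<mu> T1) + sum_list (map \<mu> T2)"
proof -
  obtain c i j v where *: "c \<in> \<Sigma>" "i < n" "j < n" "upd c (T1 ! i) (T2 ! j) = Some v"
    "S1 = T1[i := v]" "S2 = T2[j := v]"
    using assms(1)
  proof cases
    case (diagonal k v)
    then show thesis using that[of d k k v] mem by simp
  next
    case (cell x y v)
    have "x * n + y < n * n" using mult_le_mono1[of "Suc x" n n] cell by simp
    then have "w ! (x * n + y) \<in> \<Sigma>" using assms(2,3) by (auto simp: subset_iff)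
    then show thesis using that[of "w ! (x * n + y)" y x v] cell by simp
  qed
  have T: "T1 ! i \<in> \<Sigma>" "T2 ! j \<in> \<Sigma>" using * assms(4-7) by (auto simp: subset_iff)
  have v: "v \<in> \<Sigma>" using upd_mem[OF *(1) T *(4)] .
  show "length S1 = n" "length S2 = n" using * assms by auto
  show "set S1 \<subseteq> \<Sigma>" "set S2 \<subseteq> \<Sigma>"
    using v assms(6,7) set_update_subset_insert unfolding *(5,6) by fastforce+
  \<comment> \<open>An additive form, because subtraction of natural numbers truncates.\<close>
  have sum: "sum_list (map \<mu> (T[i := v])) + \<mu> (T ! i) = sum_list (map \<mu> T) + \<mu> v"
    if "i < length T" for T :: "'i list" and i
    using that elem_le_sum_list[of i "map \<mu> T"]
    by (simp add: map_update sum_list_update)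
  show "sum_list (map \<mu> S1) + sum_list (map \<mu> S2) < sum_list (map \<mu> T1) + sum_list (map \<mu> T2)"
    using sum[of i T1] sum[of j T2] upd_less[OF *(1) T *(4)] * assms(4,5) by simp
qed

text \<open>Each pass that changes something lowers the total of \<open>\<mu>\<close> over both
  tables, so the number of passes exceeds the initial total by at most one.\<close>

lemma run_to_stable:
  assumes w: "set w \<subseteq> \<Sigma>" "length w = n * n"
    and "length T1 = n" "length T2 = n" "set T1 \<subseteq> \<Sigma>" "set T2 \<subseteq> \<Sigma>"
  shows "\<exists>S1 S2. (change w n)\<^sup>*\<^sup>* (T1, T2) (S1, S2) \<and> stable w n S1 S2 \<and>
    length S1 = n \<and> length S2 = n \<and> set S1 \<subseteq> \<Sigma> \<and> set S2 \<subseteq> \<Sigma> \<and>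
    reach M (Suc (sum_list (map \<mu> T1) + sum_list (map \<mu> T2)) * pass_time n)
      (cfg 4 w 0 T1 0 T2 0) (cfg 8 w 0 S1 0 S2 0)"
  using assms(3-)
proof (induction "sum_list (map \<mu> T1) + sum_list (map \<mu> T2)" arbitrary: T1 T2 rule: less_induct)
  case less
  let ?m = "\<lambda>T1 T2. sum_list (map \<mu> T1) + sum_list (map \<mu> T2)"
  consider S1 S2 where "change w n (T1, T2) (S1, S2)"
      "reach M (pass_time n) (cfg 4 w 0 T1 0 T2 0) (cfg 4 w 0 S1 0 S2 0)"
    | "stable w n T1 T2" "reach M (pass_time n) (cfg 4 w 0 T1 0 T2 0) (cfg 8 w 0 T1 0 T2 0)"
    using pass[OF less.prems(1,2) w(2)] by blast
  then show ?case
  proof cases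
    case 1
    note S = change_props[OF 1(1) w less.prems]
    obtain R1 R2 where R: "(change w n)\<^sup>*\<^sup>* (S1, S2) (R1, R2)" "stable w n R1 R2"
      "length R1 = n" "length R2 = n" "set R1 \<subseteq> \<Sigma>" "set R2 \<subseteq> \<Sigma>"
      "reach M (Suc (?m S1 S2) * pass_time n) (cfg 4 w 0 S1 0 S2 0) (cfg 8 w 0 R1 0 R2 0)"
      using less.hyps[OF S(5) S(1-4)] by blast
    have "Suc (Suc (?m S1 S2)) * pass_time n \<le> Suc (?m T1 T2) * pass_time n"
      using S(5) by (intro mult_le_mono1) simp
    then have "reach M (Suc (?m T1 T2) * pass_time n) (cfg 4 w 0 T1 0 T2 0) (cfg 8 w 0 R1 0 R2 0)"
      using reach_trans[OF 1(2) R(7)] by simp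
    moreover have "(change w n)\<^sup>*\<^sup>* (T1, T2) (R1, R2)"
      using 1(1) R(1) by (rule converse_rtranclp_into_rtranclp)
    ultimately show ?thesis using R by blast
  next
    case 2
    then have "reach M (Suc (?m T1 T2) * pass_time n) (cfg 4 w 0 T1 0 T2 0) (cfg 8 w 0 T1 0 T2 0)"
      by (auto elim!: reach_mono)
    then show ?thesis using 2 less.prems by blast
  qed
qed

section \<open>Output, construction of the tables and the time bound\<close>

definition result :: "'i list \<Rightarrow> nat \<Rightarrow> 'i list \<Rightarrow> 'i list" where
  "result w n T = map (\<lambda>p. out (w ! p) (T ! (p div n))) [0..<n * n]"

lemma final:
  assumes len: "length T1 = n" "length T2 = n" "length w = n * n"
  obtains j k where
    "reach M (2 * (n * n) + 4 * n) (cfg 8 w 0 T1 0 T2 0) (cfg 8 (result w n T2) (int (n * n)) T1 j T2 k)"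
proof (cases n)
  case 0
  then show ?thesis using that[of 0 0] len by (simp add: result_def)
next
  case (Suc m)
  \<comment> \<open>Tape 0 with its first \<open>p\<close> cells already replaced. Overwriting in
    place is safe because the output at a cell depends only on the letter there and on
    \<open>T2\<close>.\<close>
  define W where "W p = take p (result w n T2) @ drop p w" for p
  have lr: "length (result w n T2) = n * n" by (simp add: result_def)
  have lW: "length (W p) = n * n" for p by (simp add: W_def lr len min_def)
  have W_Suc: "W (Suc p) = (W p)[p := out (w ! p) (T2 ! (p div n))]" if "p < n * n" for p
    using that lr len by (auto simp: W_def result_def take_Suc_conv_app_nth list_update_append
        Cons_nth_drop_Suc[symmetric] min_def)
  have W_nth: "W p ! p = w ! p" if "p < n * n" for p
    using that by (simp add: W_def nth_append lr min_def len)
  have "reach M (m * (2 * n + 3) + n) (cfg 8 (W 0) 0 T1 0 T2 0)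
     (cfg 8 (W (m * n + n)) (int (m * n + n)) T1 (int n) T2 (int m))"
  proof (rule sweep[where b = "n * n" and q' = 10])
    fix x y assume xy: "x < n" "y < n" "x * n + y < n * n"
    let ?p = "x * n + y"
    have "word_cells (W ?p) (int ?p) = Letter (w ! ?p)"
      using word_cells_nth[of ?p "W ?p"] xy lW W_nth by simp
    moreover have "?p div n = x" using xy by simp
    moreover have "(word_cells (W ?p))(int ?p := Letter v) = word_cells ((W ?p)[?p := v])" for v
      using xy lW by (intro word_cells_update) simp
    ultimately show "step M (cfg 8 (W ?p) (int ?p) T1 (int y) T2 (int x)) =
        Some (cfg 8 (W (Suc ?p)) (int (Suc ?p)) T1 (int (Suc y)) T2 (int x))"
      using xy len(1,2) W_Suc[OF xy(3)]
      by (simp add: step_simps del: of_nat_add of_nat_mult, simp add: cfg_def fun_upd_idem)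
  qed (use Suc len lW in auto)
  moreover have "m * n + n = n * n" using Suc by simp
  moreover have "W 0 = w" "W (n * n) = result w n T2" using len lr by (simp_all add: W_def)
  ultimately have "reach M (m * (2 * n + 3) + n) (cfg 8 w 0 T1 0 T2 0)
     (cfg 8 (result w n T2) (int (n * n)) T1 (int n) T2 (int m))"
    by simp
  then show ?thesis
    by (intro that) (erule reach_mono, simp add: Suc algebra_simps)
qed

text \<open>The configuration \<open>t\<close> input cells into the round that starts with \<open>m\<close> entries.\<close>

definition fill :: "'i list \<Rightarrow> nat \<Rightarrow> nat \<Rightarrow> 'i config" where
  "fill w m t = (if t \<le> m
     then cfg 1 w (int (m * m + t)) (replicate m u) (int t) (replicate m u) (int m)
     else cfg 2 w (int (m * m + t)) (replicate (Suc m) u) (2 * int m - int t)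
       (replicate (Suc m) u) (int (Suc m)))"

lemma replicate_update:
  "(word_cells (replicate m u))(int m := Letter u) = word_cells (replicate (Suc m) u)"
  using word_cells_append[of "replicate m u" u] by (simp add: replicate_append_same)

text \<open>The \<open>T1\<close> head walks right over \<open>m\<close> entries, appends one and
  walks back over \<open>m\<close>, reading one input letter per move; this is the origin of
  \<open>2 * m + 1\<close>.\<close>

lemma fill_step:
  assumes "t \<le> 2 * m" "m * m + t < length w"
  shows "step M (fill w m t) = Some (fill w m (Suc t))"
proof -
  let ?i = "int (m * m + t)"
  have c: "word_cells w ?i \<noteq> Blank"
    using assms(2) by (simp add: word_cells_eq_Blank del: of_nat_add of_nat_mult)
  consider "t < m" | "t = m" | "m < t" by linarith
  then show ?thesis
  proof cases
    case 1
    then show ?thesis using c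
      by (simp add: fill_def step_simps del: of_nat_add of_nat_mult, simp add: cfg_def fun_upd_idem)
  next
    case 2
    then show ?thesis using c
      by (simp add: fill_def step_simps del: of_nat_add of_nat_mult replicate.simps,
          simp add: cfg_def replicate_update del: replicate.simps)
  next
    case 3
    then have "0 \<le> 2 * int m - int t" "2 * int m - int t < int (length (replicate (Suc m) u))"
      using assms(1) by auto
    then have "word_cells (replicate (Suc m) u) (2 * int m - int t) \<noteq> Blank"
      by (simp only: word_cells_eq_Blank) simp
    then show ?thesis using c 3
      by (simp add: fill_def step_simps del: of_nat_add of_nat_mult replicate.simps,
          simp add: cfg_def del: replicate.simps)
  qed
qed

lemma fill_round:
  assumes "t \<le> 2 * m + 1" "m * m + t \<le> length w" "m * m < length w"
  shows "reach M (Suc t) (cfg 0 w (int (m * m)) (replicate m u) 0 (replicate m u) (int m)) (fill w m t)"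
proof -
  have "word_cells w (int (m * m)) \<noteq> Blank"
    using assms(3) by (simp add: word_cells_eq_Blank del: of_nat_mult)
  then have 1: "step M (cfg 0 w (int (m * m)) (replicate m u) 0 (replicate m u) (int m)) =
      Some (fill w m 0)"
    by (simp add: fill_def step_simps del: of_nat_mult, simp add: cfg_def)
  have "reach M 1 (fill w m i) (fill w m (Suc i))" if "i < t" for i
    by (rule reach_step, rule fill_step) (use that assms in auto)
  then have "reach M (t * 1) (fill w m 0) (fill w m t)"
    by (rule reach_iterate)
  then show ?thesis using reach_Suc[OF 1] by simp
qed

text \<open>The odd numbers \<open>1, 3, ..., 2 * m - 1\<close> add up to \<open>m * m\<close>. In
  state 2 the end of a round is tested before the end of the input, so a word of square length ends
  up in state 0. Entering and leaving a round costs two further steps.\<close>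

lemma fill_rounds:
  "m * m \<le> length w \<Longrightarrow> reach M (m * (2 * m + 3)) (cfg 0 w 0 [] 0 [] 0)
     (cfg 0 w (int (m * m)) (replicate m u) 0 (replicate m u) (int m))"
proof (induction m)
  case (Suc m)
  let ?c = "\<lambda>m. cfg 0 w (int (m * m)) (replicate m u) 0 (replicate m u) (int m)"
  have IH: "reach M (m * (2 * m + 3)) (cfg 0 w 0 [] 0 [] 0) (?c m)"
    using Suc by (simp add: algebra_simps)
  have "reach M (2 * m + 2) (?c m) (fill w m (2 * m + 1))"
    using fill_round[of "2 * m + 1" m w] Suc.prems by (simp add: algebra_simps)
  moreover have "step M (fill w m (2 * m + 1)) = Some (?c (Suc m))"
    by (simp add: fill_def step_simps del: of_nat_add of_nat_mult replicate.simps,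
        simp add: cfg_def fun_upd_idem word_cells_Blank algebra_simps del: replicate.simps)
  then have "reach M 1 (fill w m (2 * m + 1)) (?c (Suc m))" by (rule reach_step) simp
  ultimately have "reach M (2 * m + 3) (?c m) (?c (Suc m))" by (rule reach_trans) simp
  then show ?case by (rule reach_trans[OF IH]) (simp add: algebra_simps)
qed simp

text \<open>The rejected word keeps its length: a nonsquare length already excludes it from every
  \<open>NSP\<close>, and \<open>rej\<close> only has to be a letter of the target alphabet.\<close>

lemma erase:
  "i \<le> length w \<Longrightarrow>
    reach M i (cfg 11 w (int (length w) - 1) ys j zs k)
      (cfg 11 (take (length w - i) w @ replicate i rej) (int (length w - i) - 1) ys j zs k)"
proof (induction i)
  case (Suc i)
  let ?w = "\<lambda>i. take (length w - i) w @ replicate i rej"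
  let ?k = "length w - Suc i"
  have k: "length w - i = Suc ?k" using Suc.prems by simp
  then have i: "int (length w - i) - 1 = int ?k" by simp
  have "?k < length (?w i)" using Suc.prems by simp
  moreover have "(?w i)[?k := rej] = ?w (Suc i)"
    using Suc.prems unfolding k by (simp add: take_Suc_conv_app_nth list_update_append replicate_app_Cons_same)
  ultimately have "step M (cfg 11 (?w i) (int ?k) ys j zs k) =
      Some (cfg 11 (?w (Suc i)) (int ?k - 1) ys j zs k)"
    by (simp add: step_simps word_cells_update, simp add: cfg_def word_cells_update)
  then have "reach M 1 (cfg 11 (?w i) (int (length w - i) - 1) ys j zs k) (cfg 11 (?w (Suc i)) (int ?k - 1) ys j zs k)"
    unfolding i by (rule reach_step) simp
  with Suc show ?case by (intro reach_trans[OF Suc.IH]) auto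
qed simp

lemma halts_withI:
  assumes "reach M b (initial_config M w) c" "step M c = None" "fst (hd (snd c)) = word_cells v"
  shows "\<exists>t\<le>b. halts_with M w t v"
  using assms unfolding reach_def halts_with_def by (cases c) auto

lemma halts_square:
  assumes w: "set w \<subseteq> \<Sigma>" "length w = n * n"
  shows "\<exists>T1 T2. (change w n)\<^sup>*\<^sup>* (replicate n u, replicate n u) (T1, T2) \<and> stable w n T1 T2 \<and>
    length T1 = n \<and> length T2 = n \<and> set T1 \<subseteq> \<Sigma> \<and> set T2 \<subseteq> \<Sigma> \<and>
    (\<exists>t \<le> 100 * (2 * \<mu> u + 1) * (length w + 1) ^ 2. halts_with M w t (result w n T2))"
proof -
  let ?u = "replicate n u" and ?L = "length w"
  have 1: "reach M (n * (2 * n + 3)) (initial_config M w) (cfg 0 w (int (n * n)) ?u 0 ?u (int n))"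
    unfolding initial_cfg using w by (intro fill_rounds) simp
  have 2: "step M (cfg 0 w (int (n * n)) ?u 0 ?u (int n)) =
      Some (cfg 3 w (int (n * n) - 1) ?u (-1) ?u (int n - 1))"
    using w(2) by (simp add: step_simps del: of_nat_mult, simp add: cfg_def fun_upd_idem word_cells_Blank)
  have 3: "reach M (n * n + n + 1) (cfg 3 w (int (n * n) - 1) ?u (-1) ?u (int n - 1)) (cfg 4 w 0 ?u 0 ?u 0)"
  proof (rule reach_mono[OF rewind[of 3, simplified]])
    show "nat (int (n * n) - 1 + - 1 + (int n - 1) + 4) \<le> n * n + n + 1" by linarith
  qed (use w(2) in \<open>auto simp del: of_nat_mult\<close>)
  obtain T1 T2 where T: "(change w n)\<^sup>*\<^sup>* (?u, ?u) (T1, T2)" "stable w n T1 T2"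
    "length T1 = n" "length T2 = n" "set T1 \<subseteq> \<Sigma>" "set T2 \<subseteq> \<Sigma>" and
    4: "reach M (Suc (n * \<mu> u + n * \<mu> u) * pass_time n) (cfg 4 w 0 ?u 0 ?u 0) (cfg 8 w 0 T1 0 T2 0)"
  proof -
    have "set ?u \<subseteq> \<Sigma>" using mem by auto
    from run_to_stable[OF w _ _ this this] show thesis
      using that by (simp add: sum_list_replicate del: mult_Suc) blast
  qed
  obtain j k where 5: "reach M (2 * (n * n) + 4 * n) (cfg 8 w 0 T1 0 T2 0)
      (cfg 8 (result w n T2) (int (n * n)) T1 j T2 k)" (is "reach _ _ _ ?c")
    using final[OF T(3,4) w(2)] by blast
  \<comment> \<open>The tables start with total \<open>2 * n * \<mu> u\<close>, which allows at most
    \<open>?D * (?L + 1)\<close> passes of at most \<open>20 * (?L + 1)\<close> steps each. All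
    other phases are linear in \<open>?L\<close>, and the factor \<open>100\<close> absorbs
    them.\<close>
  let ?D = "2 * \<mu> u + 1"
  have n: "n \<le> ?L" unfolding w by (rule le_square)
  have "n * \<mu> u + n * \<mu> u = n * (2 * \<mu> u)" by simp
  also have "\<dots> \<le> ?L * (2 * \<mu> u)" using n by (rule mult_le_mono1)
  finally have "Suc (n * \<mu> u + n * \<mu> u) \<le> ?D * (?L + 1)" by (simp add: algebra_simps)
  moreover have "pass_time n \<le> 20 * (?L + 1)" using n w by (simp add: pass_time_def)
  ultimately have "Suc (n * \<mu> u + n * \<mu> u) * pass_time n \<le> (?D * (?L + 1)) * (20 * (?L + 1))"
    by (rule mult_le_mono)
  then have "Suc (n * \<mu> u + n * \<mu> u) * pass_time n \<le> 20 * (?D * (?L + 1) ^ 2)"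
    by (simp only: power2_eq_square ac_simps)
  moreover have "?L + 1 \<le> ?D * (?L + 1) ^ 2"
    using mult_le_mono[of 1 ?D "?L + 1" "(?L + 1) ^ 2"] self_le_power[of "?L + 1" 2] by simp
  moreover have "n * (2 * n + 3) = 2 * ?L + 3 * n" using w by (simp add: algebra_simps)
  ultimately have "n * (2 * n + 3) + (Suc (n * n + n + 1) + (Suc (n * \<mu> u + n * \<mu> u) * pass_time n +
      (2 * (n * n) + 4 * n))) \<le> 100 * (?D * (?L + 1) ^ 2)"
    using n unfolding w(2) by linarith
  then have "reach M (100 * (?D * (?L + 1) ^ 2)) (initial_config M w) ?c"
    using reach_trans[OF 1 reach_trans[OF reach_Suc[OF 2 3 order_refl] reach_trans[OF 4 5 order_refl] order_refl]]
    by simp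
  moreover have "step M ?c = None"
    by (simp add: step_simps result_def del: of_nat_mult)
  moreover have "fst (hd (snd ?c)) = word_cells (result w n T2)" by (simp add: cfg_def)
  ultimately show ?thesis using T by (metis (no_types, lifting) halts_withI mult.assoc)
qed

lemma halts_nonsquare:
  assumes w: "\<nexists>n. length w = n * n"
  shows "\<exists>t \<le> 100 * (2 * \<mu> u + 1) * (length w + 1) ^ 2. halts_with M w t (replicate (length w) rej)"
proof -
  let ?L = "length w"
  have "\<exists>m. m * m \<le> k \<and> k < Suc m * Suc m" for k :: nat
  proof (induction k)
    case (Suc k)
    then obtain m where m: "m * m \<le> k" "k < Suc m * Suc m" by blast
    show ?case
    proof (cases "Suc k < Suc m * Suc m")
      case False
      then have "Suc k = Suc m * Suc m" using m by simp
      then show ?thesis by (intro exI[of _ "Suc m"]) simp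
    qed (use m in \<open>auto intro!: exI[of _ m]\<close>)
  qed simp
  then obtain m where m: "m * m \<le> ?L" "?L < Suc m * Suc m" by blast
  define t where "t = ?L - m * m"
  \<comment> \<open>Between two consecutive squares, the input ends strictly inside a round: in
    state 1, or in state 2 with the \<open>T1\<close> head still on an entry. Both cases lead to
    state 11.\<close>
  have t: "0 < t" "t \<le> 2 * m" "m * m + t = ?L" "m * m < ?L"
    using m w by (auto simp: t_def) (metis le_neq_implies_less)+
  have m_le: "m \<le> ?L" using m(1) le_square order_trans by blast
  have 1: "reach M (m * (2 * m + 3)) (initial_config M w)
      (cfg 0 w (int (m * m)) (replicate m u) 0 (replicate m u) (int m))"
    unfolding initial_cfg using m by (intro fill_rounds) simp
  have 2: "reach M (Suc t) (cfg 0 w (int (m * m)) (replicate m u) 0 (replicate m u) (int m)) (fill w m t)"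
    using t by (intro fill_round) auto
  have c: "word_cells w (int ?L) = Blank" by (simp add: word_cells_Blank)
  obtain ys j zs k where 3: "step M (fill w m t) = Some (cfg 11 w (int ?L - 1) ys j zs k)"
  proof (cases "t \<le> m")
    case True
    then show thesis using c
      by (intro that) (simp add: fill_def t(3) step_simps del: of_nat_mult of_nat_add, simp add: cfg_def)
  next
    case False
    then have "0 \<le> 2 * int m - int t" "2 * int m - int t < int (length (replicate (Suc m) u))"
      using t by auto
    then have "word_cells (replicate (Suc m) u) (2 * int m - int t) \<noteq> Blank"
      by (simp only: word_cells_eq_Blank) simp
    then show thesis using c False
      by (intro that) (simp add: fill_def t(3) step_simps del: of_nat_mult of_nat_add replicate.simps,
          simp add: cfg_def del: replicate.simps)
  qed
  let ?c = "cfg 11 (replicate ?L rej) (- 1) ys j zs k"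
  have 4: "reach M ?L (cfg 11 w (int ?L - 1) ys j zs k) ?c"
    using erase[of ?L w] by simp
  have "?L + 1 \<le> (2 * \<mu> u + 1) * (?L + 1) ^ 2"
    using mult_le_mono[of 1 "2 * \<mu> u + 1" "?L + 1" "(?L + 1) ^ 2"] self_le_power[of "?L + 1" 2] by simp
  moreover have "m * (2 * m + 3) = 2 * (m * m) + 3 * m" by (simp add: algebra_simps)
  ultimately have "m * (2 * m + 3) + (Suc t + Suc ?L) \<le> 100 * ((2 * \<mu> u + 1) * (?L + 1) ^ 2)"
    using m(1) m_le t by linarith
  then have "reach M (100 * ((2 * \<mu> u + 1) * (?L + 1) ^ 2)) (initial_config M w) ?c"
    using reach_trans[OF 1 reach_trans[OF 2 reach_Suc[OF 3 4 order_refl] order_refl]] by simp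
  moreover have "step M ?c = None" by (simp add: step_simps)
  moreover have "fst (hd (snd ?c)) = word_cells (replicate ?L rej)" by (simp add: cfg_def)
  ultimately show ?thesis by (metis (no_types, lifting) halts_withI mult.assoc)
qed

theorem polytime_computable_fixpoint:
  obtains f where "polytime_computable \<Sigma> f"
    "\<And>w. \<lbrakk>set w \<subseteq> \<Sigma>; \<nexists>n. length w = n * n\<rbrakk> \<Longrightarrow> f w = replicate (length w) rej"
    "\<And>w n. \<lbrakk>set w \<subseteq> \<Sigma>; length w = n * n\<rbrakk> \<Longrightarrow> \<exists>T1 T2. f w = result w n T2 \<and>
       (change w n)\<^sup>*\<^sup>* (replicate n u, replicate n u) (T1, T2) \<and> stable w n T1 T2 \<and>
       length T1 = n \<and> length T2 = n \<and> set T1 \<subseteq> \<Sigma> \<and> set T2 \<subseteq> \<Sigma>"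
proof -
  \<comment> \<open>The final tables are only known to exist, so \<open>f\<close> is obtained by
    choice, and \<open>good\<close> collects everything the chosen output must satisfy. The clause
    for all \<open>n\<close> concerns a single \<open>n\<close>, as the length determines
    it.\<close>
  define good where "good w v \<longleftrightarrow>
    (\<exists>t \<le> 100 * (2 * \<mu> u + 1) * (length w + 1) ^ 2. halts_with M w t v) \<and>
    ((\<nexists>n. length w = n * n) \<longrightarrow> v = replicate (length w) rej) \<and>
    (\<forall>n. length w = n * n \<longrightarrow> (\<exists>T1 T2. v = result w n T2 \<and>
       (change w n)\<^sup>*\<^sup>* (replicate n u, replicate n u) (T1, T2) \<and> stable w n T1 T2 \<and>
       length T1 = n \<and> length T2 = n \<and> set T1 \<subseteq> \<Sigma> \<and> set T2 \<subseteq> \<Sigma>))" for w v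
  have sq: "m * m = n * n \<Longrightarrow> m = n" for m n :: nat
    by (metis power2_eq_square power2_eq_imp_eq zero_le)
  have ex: "\<exists>v. good w v" if "set w \<subseteq> \<Sigma>" for w
  proof (cases "\<exists>n. length w = n * n")
    case True
    then obtain n where n: "length w = n * n" by blast
    then show ?thesis using halts_square[OF that n] sq[of n] unfolding good_def n by metis
  next
    case False
    then show ?thesis using halts_nonsquare[OF False] unfolding good_def by blast
  qed
  define f where "f w = (SOME v. good w v)" for w
  have f: "good w (f w)" if "set w \<subseteq> \<Sigma>" for w
    unfolding f_def using ex[OF that] by (rule someI_ex)
  let ?p = "[:100 * (2 * \<mu> u + 1):] * [:1, 1:] ^ 2"
  have "\<exists>t\<le>poly ?p (length w). halts_with M w t (f w)" if "w \<in> lists \<Sigma>" for w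
  proof -
    have "good w (f w)" using that by (intro f) auto
    then show ?thesis unfolding good_def by (simp add: poly_power ac_simps)
  qed
  moreover have "Letter ` \<Sigma> \<subseteq> symbols M" by (auto simp: M_def)
  ultimately have "polytime_computable \<Sigma> f"
    unfolding polytime_computable_def using wf_M by blast
  then show thesis
  proof (rule that)
    fix w assume "set w \<subseteq> \<Sigma>"
    from f[OF this] show "\<nexists>n. length w = n * n \<Longrightarrow> f w = replicate (length w) rej"
      "\<And>n. length w = n * n \<Longrightarrow> \<exists>T1 T2. f w = result w n T2 \<and>
        (change w n)\<^sup>*\<^sup>* (replicate n u, replicate n u) (T1, T2) \<and> stable w n T1 T2 \<and>
        length T1 = n \<and> length T2 = n \<and> set T1 \<subseteq> \<Sigma> \<and> set T2 \<subseteq> \<Sigma>"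
      unfolding good_def by blast+
  qed
qed

end

section \<open>The integral part of an algebra with a flexible atom\<close>

definition meet :: "'a rel_alg \<Rightarrow> 'a \<Rightarrow> 'a \<Rightarrow> 'a" where
  "meet A x y = compl A (join A (compl A x) (compl A y))"

section \<open>Computing in an algebra through a representation\<close>

locale represented =
  fixes A :: "'a rel_alg" and B :: "'d set" and r :: "'a \<Rightarrow> ('d \<times> 'd) set"
  assumes rep: "representation A B r"
begin

lemma closed [simp]:
  "zero A \<in> carrier A" "one A \<in> carrier A" "ident A \<in> carrier A"
  "x \<in> carrier A \<Longrightarrow> compl A x \<in> carrier A" "x \<in> carrier A \<Longrightarrow> conv A x \<in> carrier A"
  "x \<in> carrier A \<Longrightarrow> y \<in> carrier A \<Longrightarrow> join A x y \<in> carrier A"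
  "x \<in> carrier A \<Longrightarrow> y \<in> carrier A \<Longrightarrow> comp A x y \<in> carrier A"
  using rep[unfolded representation_def, THEN conjunct1] unfolding closed_under_ops_def by simp_all

lemma r_simps [simp]:
  "r (zero A) = {}" "r (ident A) = Id_on B"
  "x \<in> carrier A \<Longrightarrow> r (compl A x) = r (one A) - r x"
  "x \<in> carrier A \<Longrightarrow> r (conv A x) = (r x)\<inverse>"
  "x \<in> carrier A \<Longrightarrow> y \<in> carrier A \<Longrightarrow> r (join A x y) = r x \<union> r y"
  "x \<in> carrier A \<Longrightarrow> y \<in> carrier A \<Longrightarrow> r (comp A x y) = r x O r y"
  using rep unfolding representation_iff by simp_all

lemma equiv_one: "equiv B (r (one A))"
  using rep unfolding representation_iff by simp_all

lemma r_sub: "x \<in> carrier A \<Longrightarrow> r x \<subseteq> r (one A)"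
  using rep unfolding representation_iff by simp_all

lemma r_field: "x \<in> carrier A \<Longrightarrow> r x \<subseteq> B \<times> B"
  using r_sub equiv_one unfolding equiv_def refl_on_def by blast

lemma one_refl: "x \<in> B \<Longrightarrow> (x, x) \<in> r (one A)"
  using equiv_one unfolding equiv_def refl_on_def by blast

lemma one_sym: "(x, y) \<in> r (one A) \<Longrightarrow> (y, x) \<in> r (one A)"
  using equiv_one unfolding equiv_def sym_def by blast

lemma meet_closed [simp]: "x \<in> carrier A \<Longrightarrow> y \<in> carrier A \<Longrightarrow> meet A x y \<in> carrier A"
  by (simp add: meet_def)

lemma r_meet [simp]: "x \<in> carrier A \<Longrightarrow> y \<in> carrier A \<Longrightarrow> r (meet A x y) = r x \<inter> r y"
  using r_sub by (auto simp: meet_def)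

lemma eq_iff: "x \<in> carrier A \<Longrightarrow> y \<in> carrier A \<Longrightarrow> x = y \<longleftrightarrow> r x = r y"
proof -
  have "inj_on r (carrier A)" using rep unfolding representation_iff by simp
  then show "x \<in> carrier A \<Longrightarrow> y \<in> carrier A \<Longrightarrow> x = y \<longleftrightarrow> r x = r y" by (auto dest: inj_onD)
qed

lemma leq_iff: "x \<in> carrier A \<Longrightarrow> y \<in> carrier A \<Longrightarrow> leq A x y \<longleftrightarrow> r x \<subseteq> r y"
  unfolding leq_def by (subst eq_iff) auto

lemma atoms_iff:
  "a \<in> atoms A \<longleftrightarrow> a \<in> carrier A \<and> r a \<noteq> {} \<and> (\<forall>y\<in>carrier A. r y \<noteq> {} \<longrightarrow> r y \<subseteq> r a \<longrightarrow> y = a)"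
proof -
  have "x = zero A \<longleftrightarrow> r x = {}" if "x \<in> carrier A" for x
    using eq_iff[OF that closed(1)] by simp
  then show ?thesis by (simp add: atoms_def Ball_def leq_iff cong: conj_cong imp_cong) blast
qed

lemma atom_nonempty: "a \<in> atoms A \<Longrightarrow> r a \<noteq> {}"
  unfolding atoms_iff by blast

lemma atom_carrier: "a \<in> atoms A \<Longrightarrow> a \<in> carrier A"
  by (simp add: atoms_def)

lemma atom_sub:
  assumes "a \<in> atoms A" "x \<in> carrier A" "p \<in> r a" "p \<in> r x"
  shows "r a \<subseteq> r x"
proof -
  have a: "a \<in> carrier A" using assms(1) by (rule atom_carrier)
  then have "r (meet A a x) = r a \<inter> r x" using assms(2) by simp
  moreover have "meet A a x \<in> carrier A" using a assms(2) by simp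
  ultimately have "meet A a x = a" using assms(1,3,4) unfolding atoms_iff by blast
  then show ?thesis using \<open>r (meet A a x) = r a \<inter> r x\<close> by auto
qed

text \<open>Take a minimal \<open>a\<close> among the finitely many elements containing
  \<open>p\<close>. If some \<open>y\<close> below \<open>a\<close> misses \<open>p\<close>, then
  \<open>a\<close> without \<open>y\<close> still contains \<open>p\<close>, so minimality makes
  \<open>y\<close> empty.\<close>

lemma exists_atom:
  assumes "finite (carrier A)" "x \<in> carrier A" "p \<in> r x"
  obtains a where "a \<in> atoms A" "p \<in> r a" "r a \<subseteq> r x"
proof -
  let ?S = "{y \<in> carrier A. p \<in> r y}"
  obtain m where m: "m \<in> r ` ?S" "\<forall>b\<in>r ` ?S. b \<subseteq> m \<longrightarrow> m = b"
    using finite_has_minimal[of "r ` ?S"] assms by auto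
  then obtain a where a: "a \<in> carrier A" "p \<in> r a" "m = r a" by auto
  have "y = a" if y: "y \<in> carrier A" "r y \<noteq> {}" "r y \<subseteq> r a" for y
  proof (cases "p \<in> r y")
    case True
    then show ?thesis using m a y eq_iff by auto
  next
    case False
    then have "meet A a (compl A y) \<in> ?S" using a y r_sub[OF a(1)] by auto
    moreover have "r (meet A a (compl A y)) \<subseteq> m" using a y by auto
    ultimately have "r a = r (meet A a (compl A y))" using m(2) a(3) by blast
    then have "r a \<inter> r y = {}" using a y by auto
    then show ?thesis using y by blast
  qed
  then have "a \<in> atoms A" using a unfolding atoms_iff by auto
  then show thesis using that a atom_sub assms by blast
qed

end

section \<open>Separating the isolated points from the part below \<open>e\<close>\<close>

locale flexible_algebra =
  fixes A :: "'a rel_alg" and s e :: 'a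
  assumes finite: "finite (carrier A)" and representable: "representable A"
    and flexible: "flexible A s"
    and e: "e \<in> atoms A" "leq A e (ident A)" "leq A s (comp A e s)"
begin

definition u :: 'a where
  "u = meet A (ident A) (compl A e)"

abbreviation top' :: 'a where
  "top' \<equiv> compl A u"

text \<open>Only complement, unit and identity have to be relativised; the elements below
  \<open>top'\<close> are already closed under join, converse and composition.\<close>

definition A' :: "'a rel_alg" where
  "A' = A\<lparr>carrier := {a \<in> carrier A. leq A a top'}, compl := \<lambda>a. meet A (compl A a) top',
          one := top', ident := e\<rparr>"

lemma A'_simps [simp]:
  "carrier A' = {a \<in> carrier A. leq A a top'}" "compl A' a = meet A (compl A a) top'"
  "one A' = top'" "ident A' = e" "zero A' = zero A" "join A' = join A" "conv A' = conv A"
  "comp A' = comp A"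
  by (simp_all add: A'_def)

lemma leq_A' [simp]: "leq A' = leq A"
  by (simp add: leq_def fun_eq_iff)

definition U :: "'a set" where
  "U = {a \<in> atoms A. leq A a u}"

end

locale flexible_rep = flexible_algebra A s e + represented A B r
  for A :: "'a rel_alg" and s e and B :: "'d set" and r
begin

definition C :: "'d set" where
  "C = {x. (x, x) \<in> r e}"

lemma e_carrier [simp]: "e \<in> carrier A"
  using e atom_carrier by blast

lemma s_carrier [simp]: "s \<in> carrier A"
  using flexible atom_carrier unfolding flexible_def by blast

lemma u_carrier [simp]: "u \<in> carrier A"
  by (simp add: u_def)

lemma r_e: "r e = Id_on C"
  using e(2) by (auto simp: leq_iff C_def)

lemma C_sub: "C \<subseteq> B"
  using r_field[OF e_carrier] by (auto simp: C_def)

lemma r_s_nonempty: "r s \<noteq> {}"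
  using flexible atom_nonempty unfolding flexible_def by blast

lemma C_nonempty: "C \<noteq> {}"
  using atom_nonempty[OF e(1)] unfolding r_e by auto

text \<open>If \<open>a\<close> is the atom containing a pair \<open>(x, y)\<close> off the diagonal, then \<open>s \<le> a \<circ> s\<close>, so \<open>a\<close> and
  \<open>e \<circ> a\<close> share a pair, whence \<open>a \<le> e \<circ> a\<close>.\<close>

lemma off_diagonal:
  assumes "(x, y) \<in> r (one A)" "x \<noteq> y"
  shows "x \<in> C" "y \<in> C"
proof -
  have first: "x \<in> C" if xy: "(x, y) \<in> r (one A)" "x \<noteq> y" for x y
  proof -
    obtain a where a: "a \<in> atoms A" "(x, y) \<in> r a"
      using exists_atom[OF finite closed(2) xy(1)] by blast
    then have ac: "a \<in> carrier A" using atom_carrier by blast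
    have "a \<notin> subidentities A" using a xy ac by (auto simp: subidentities_def leq_iff)
    moreover have "s \<notin> subidentities A" using flexible by (simp add: flexible_def)
    ultimately have "r s \<subseteq> r a O r s"
      using flexible ac unfolding flexible_def by (auto simp: leq_iff)
    moreover obtain p q where pq: "(p, q) \<in> r s" using r_s_nonempty by auto
    ultimately obtain z where z: "(p, z) \<in> r a" by auto
    have "r s \<subseteq> r e O r s" using e(3) by (simp add: leq_iff)
    then have "p \<in> C" using pq by (auto simp: r_e)
    then have "(p, z) \<in> r (comp A e a)" using z ac by (auto simp: r_e)
    then have "r a \<subseteq> r (comp A e a)" using atom_sub[OF a(1) closed(7)[OF e_carrier ac] z] by simp
    then show ?thesis using a ac by (auto simp: r_e)
  qed
  show "x \<in> C" using first assms .
  show "y \<in> C" using first[of y x] assms one_sym by auto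
qed

lemma r_u: "r u = Id_on (B - C)"
  using one_refl by (auto simp: u_def r_e)

lemma r_top: "r top' = r (one A) \<inter> C \<times> C"
proof -
  have "(x, y) \<in> r top' \<longleftrightarrow> (x, y) \<in> r (one A) \<and> \<not> (x = y \<and> x \<in> B - C)" for x y
    by (auto simp: r_u)
  moreover have "x \<in> C \<and> y \<in> C \<longleftrightarrow> \<not> (x = y \<and> x \<in> B - C)" if "(x, y) \<in> r (one A)" for x y
    using off_diagonal[OF that] that r_field[OF closed(2)] by blast
  ultimately show ?thesis by (auto simp del: r_simps(3))
qed

lemma one_cases:
  assumes "(x, y) \<in> r (one A)"
  obtains "x \<in> C" "y \<in> C" | "x = y" "x \<in> B" "x \<notin> C"
  using assms off_diagonal[OF assms] r_field[OF closed(2)] by blast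

lemma A'_leq: "a \<in> carrier A \<Longrightarrow> leq A a top' \<longleftrightarrow> r a \<subseteq> C \<times> C"
  using r_sub[of a] unfolding leq_iff[OF _ closed(4)[OF u_carrier]] r_top by blast

text \<open>Elements of \<open>A'\<close> relate only points of \<open>C\<close>, so the same
  \<open>r\<close> works on the smaller domain.\<close>

lemma restrict_representation: "representation A' C r"
  unfolding representation_iff
proof (intro conjI ballI)
  have top: "a \<in> carrier A' \<longleftrightarrow> a \<in> carrier A \<and> r a \<subseteq> C \<times> C" for a
    using A'_leq by auto
  show "closed_under_ops A' (carrier A')"
    unfolding closed_under_ops_def Ball_def top by (auto simp: r_e r_top dest: subsetD)
  show "equiv C (r (one A'))"
    using equiv_one C_sub unfolding equiv_def refl_on_def sym_def trans_def A'_simps r_top by blast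
  show "inj_on r (carrier A')" using eq_iff by (auto simp: inj_on_def)
  fix x assume x: "x \<in> carrier A'"
  then show "r x \<subseteq> r (one A')" "r (conv A' x) = (r x)\<inverse>"
    by (auto simp: leq_iff)
  show "r (compl A' x) = r (one A') - r x" using x by auto
  fix y assume y: "y \<in> carrier A'"
  show "r (join A' x y) = r x \<union> r y" "r (comp A' x y) = r x O r y" using x y by auto
qed (simp_all add: r_e)

lemma U_point:
  assumes "j \<in> U"
  obtains p where "p \<in> B" "p \<notin> C" "\<And>x. x \<in> carrier A \<Longrightarrow> leq A j x \<longleftrightarrow> (p, p) \<in> r x"
proof -
  have j: "j \<in> atoms A" "r j \<subseteq> Id_on (B - C)"
    using assms atom_carrier unfolding U_def by (auto simp: leq_iff r_u[symmetric])
  then obtain p where p: "(p, p) \<in> r j" "p \<in> B" "p \<notin> C"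
    unfolding atoms_iff by fastforce
  have "leq A j x \<longleftrightarrow> (p, p) \<in> r x" if "x \<in> carrier A" for x
    using atom_sub[OF j(1) that p(1)] p(1) that j(1) atom_carrier by (auto simp: leq_iff)
  then show thesis using that p by blast
qed

text \<open>The loop at an isolated point decides \<open>leq A j\<close>. Hence each
  \<open>j\<close> in \<open>U\<close> yields a homomorphism to the algebra of a one-point set,
  where composition is intersection and converse is trivial.\<close>

lemma U_leq:
  assumes "j \<in> U"
  shows "\<not> leq A j (zero A)" "leq A j (one A)" "leq A j (ident A)"
    "x \<in> carrier A \<Longrightarrow> leq A j (compl A x) \<longleftrightarrow> \<not> leq A j x"
    "x \<in> carrier A \<Longrightarrow> leq A j (conv A x) \<longleftrightarrow> leq A j x"
    "\<lbrakk>x \<in> carrier A; y \<in> carrier A\<rbrakk> \<Longrightarrow> leq A j (join A x y) \<longleftrightarrow> leq A j x \<or> leq A j y"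
    "\<lbrakk>x \<in> carrier A; y \<in> carrier A\<rbrakk> \<Longrightarrow> leq A j (comp A x y) \<longleftrightarrow> leq A j x \<and> leq A j y"
proof -
  obtain p where p: "p \<in> B" "p \<notin> C" "\<And>x. x \<in> carrier A \<Longrightarrow> leq A j x \<longleftrightarrow> (p, p) \<in> r x"
    by (rule U_point[OF assms]) (rule that)
  show "\<not> leq A j (zero A)" "leq A j (one A)" "leq A j (ident A)"
    using p one_refl by auto
  show "leq A j (compl A x) \<longleftrightarrow> \<not> leq A j x" "leq A j (conv A x) \<longleftrightarrow> leq A j x" if "x \<in> carrier A"
    using p one_refl that by auto
  assume xy: "x \<in> carrier A" "y \<in> carrier A"
  then show "leq A j (join A x y) \<longleftrightarrow> leq A j x \<or> leq A j y" using p by auto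
  have "z = p" if "(p, z) \<in> r x" for z
    using off_diagonal[of p z] r_sub[OF xy(1)] p that by blast
  then show "leq A j (comp A x y) \<longleftrightarrow> leq A j x \<and> leq A j y" using p(3) xy by auto
qed

lemma exists_U:
  assumes "x \<in> carrier A" "(p, q) \<in> r x" "(p, q) \<notin> C \<times> C"
  obtains j where "j \<in> U" "(p, q) \<in> r j" "leq A j x"
proof -
  obtain a where a: "a \<in> atoms A" "(p, q) \<in> r a" "r a \<subseteq> r x"
    using exists_atom[OF finite assms(1,2)] .
  have "(p, q) \<in> r (one A)" using assms r_sub by blast
  then have "(p, q) \<in> r u" using assms(3) by (cases rule: one_cases) (auto simp: r_u)
  then have "a \<in> U" using atom_sub[OF a(1) u_carrier a(2)] a(1) atom_carrier by (simp add: U_def leq_iff)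
  then show thesis using that a assms atom_carrier by (simp add: leq_iff)
qed

text \<open>Relativisation to \<open>top'\<close> is a homomorphism from \<open>A\<close> to
  \<open>A'\<close>. For composition, an intermediate point between points of \<open>C\<close> lies
  in \<open>C\<close> itself, since distinct related points do.\<close>

lemma top_meet:
  "meet A (zero A) top' = zero A" "meet A (one A) top' = top'" "meet A (ident A) top' = e"
  "x \<in> carrier A \<Longrightarrow> meet A (compl A x) top' = compl A' (meet A x top')"
  "x \<in> carrier A \<Longrightarrow> meet A (conv A x) top' = conv A (meet A x top')"
  "\<lbrakk>x \<in> carrier A; y \<in> carrier A\<rbrakk> \<Longrightarrow>
    meet A (join A x y) top' = join A (meet A x top') (meet A y top')"
  "\<lbrakk>x \<in> carrier A; y \<in> carrier A\<rbrakk> \<Longrightarrow>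
    meet A (comp A x y) top' = comp A (meet A x top') (meet A y top')"
proof -
  show "meet A (zero A) top' = zero A" "meet A (one A) top' = top'"
    by (simp_all add: eq_iff) auto
  show "meet A (ident A) top' = e"
    using C_sub one_refl by (auto simp: eq_iff r_top r_e simp del: r_simps(3))
  show "meet A (compl A x) top' = compl A' (meet A x top')" if "x \<in> carrier A"
    using that by (auto simp: eq_iff)
  show "meet A (conv A x) top' = conv A (meet A x top')" if "x \<in> carrier A"
    using that by (auto simp: eq_iff r_top simp del: r_simps(3) intro: one_sym)
  assume xy: "x \<in> carrier A" "y \<in> carrier A"
  then show "meet A (join A x y) top' = join A (meet A x top') (meet A y top')"
    by (auto simp: eq_iff)
  have "(a, c) \<in> (r x \<inter> r top') O (r y \<inter> r top')" if "(a, b) \<in> r x" "(b, c) \<in> r y" "a \<in> C" "c \<in> C" for a b c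
  proof -
    have "(a, b) \<in> r (one A)" "(b, c) \<in> r (one A)" using that r_sub xy by blast+
    moreover have "b \<in> C" using off_diagonal[of a b] that \<open>(a, b) \<in> r (one A)\<close> by blast
    ultimately show ?thesis using that by (auto simp: r_top simp del: r_simps(3))
  qed
  moreover have "r x O r y \<subseteq> r (one A)" using r_sub[of "comp A x y"] xy by simp
  ultimately show "meet A (comp A x y) top' = comp A (meet A x top') (meet A y top')"
    using xy by (auto simp: eq_iff r_top simp del: r_simps(3))
qed

text \<open>Relativisation and the homomorphisms given by \<open>U\<close> jointly separate
  elements; this makes the extended representation injective.\<close>

lemma decompose:
  assumes "x \<in> carrier A" "y \<in> carrier A" "meet A x top' = meet A y top'" "\<And>j. j \<in> U \<Longrightarrow> leq A j x \<longleftrightarrow> leq A j y"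
  shows "x = y"
proof -
  have "r x \<subseteq> r y" if xy: "x \<in> carrier A" "y \<in> carrier A" "meet A x top' = meet A y top'"
      "\<And>j. j \<in> U \<Longrightarrow> leq A j x \<longleftrightarrow> leq A j y" for x y
  proof clarify
    fix p q assume pq: "(p, q) \<in> r x"
    have one: "(p, q) \<in> r (one A)" using pq xy r_sub by blast
    show "(p, q) \<in> r y"
    proof (cases "(p, q) \<in> C \<times> C")
      case True
      then have "(p, q) \<in> r (meet A x top')"
        using pq one xy(1) by (simp add: r_top del: r_simps(3))
      then show ?thesis unfolding xy(3) using xy(2) by simp
    next
      case False
      then obtain j where j: "j \<in> U" "(p, q) \<in> r j" "leq A j x" using exists_U xy(1) pq by blast
      then have "leq A j y" using xy(4) by simp
      then show ?thesis using j xy atom_carrier by (auto simp: leq_iff U_def)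
    qed
  qed
  from this[OF assms] this[OF assms(2,1)] show ?thesis using assms eq_iff by auto
qed

end

section \<open>Extending representations of \<open>A'\<close>, and the properties of
  \<open>A'\<close>\<close>

context flexible_algebra
begin

lemma obtain_rep:
  obtains B :: "nat set" and r where "flexible_rep A s e B r"
  using representable unfolding representable_def
  by (auto simp: flexible_rep_def flexible_algebra_axioms represented_def)

text \<open>One new isolated point per atom below \<open>u\<close> realises the Boolean
  factor.\<close>

definition extend_dom :: "'d set \<Rightarrow> ('d + 'a) set" where
  "extend_dom B = Inl ` B \<union> Inr ` U"

definition extend_rel :: "('a \<Rightarrow> ('d \<times> 'd) set) \<Rightarrow> 'a \<Rightarrow> (('d + 'a) \<times> ('d + 'a)) set" where
  "extend_rel r a = {(Inl x, Inl y) | x y. (x, y) \<in> r (meet A a top')} \<union>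
     {(Inr j, Inr j) | j. j \<in> U \<and> leq A j a}"

lemma extend_representation:
  assumes "representation A' B r"
  shows "representation A (extend_dom B) (extend_rel r)"
proof -
  interpret R: represented A' B r by unfold_locales (rule assms)
  \<comment> \<open>This representation of \<open>A\<close> has nothing to do with \<open>r\<close>;
    it only supplies the algebraic laws of \<open>A\<close>.\<close>
  obtain B0 :: "nat set" and r0 where "flexible_rep A s e B0 r0" using obtain_rep .
  then interpret F: flexible_rep A s e B0 r0 .
  have m: "meet A x top' \<in> carrier A'" if "x \<in> carrier A" for x
    using that by (simp add: F.leq_iff)
  note Rr = R.r_simps(1)[unfolded A'_simps] R.r_simps(2)[unfolded A'_simps] R.r_simps(3)[OF m, unfolded A'_simps]
     R.r_simps(4)[OF m, unfolded A'_simps] R.r_simps(5,6)[OF m m, unfolded A'_simps]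
  have tm: "meet A (compl A x) top' = meet A (compl A (meet A x top')) top'" if "x \<in> carrier A" for x
    using F.top_meet(4)[OF that] by simp
  show ?thesis
    unfolding representation_iff
  proof (intro conjI ballI)
    show "closed_under_ops A (carrier A)" by (simp add: closed_under_ops_def)
    show "equiv (extend_dom B) (extend_rel r (one A))"
      using R.equiv_one F.U_leq(2)
      unfolding equiv_def refl_on_def sym_def trans_def extend_dom_def extend_rel_def F.top_meet A'_simps
      by blast
    show "inj_on (extend_rel r) (carrier A)"
    proof (rule inj_onI)
      fix x y assume xy: "x \<in> carrier A" "y \<in> carrier A" "extend_rel r x = extend_rel r y"
      have "(p, q) \<in> r (meet A x top') \<longleftrightarrow> (p, q) \<in> r (meet A y top')" for p q
      proof -
        have "(p, q) \<in> r (meet A z top') \<longleftrightarrow> (Inl p, Inl q) \<in> extend_rel r z" for z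
          by (auto simp: extend_rel_def)
        then show ?thesis using xy(3) by simp
      qed
      then have "meet A x top' = meet A y top'"
        using R.eq_iff[OF m[OF xy(1)] m[OF xy(2)]] by auto
      moreover have "leq A j x \<longleftrightarrow> leq A j y" if "j \<in> U" for j
      proof -
        have "leq A j z \<longleftrightarrow> (Inr j, Inr j) \<in> extend_rel r z" for z
          using that by (auto simp: extend_rel_def)
        then show ?thesis using xy(3) by simp
      qed
      ultimately show "x = y" using F.decompose xy by blast
    qed
    show "extend_rel r (zero A) = {}"
      using F.U_leq(1) by (auto simp: extend_rel_def F.top_meet Rr)
    show "extend_rel r (ident A) = Id_on (extend_dom B)"
      using F.U_leq(3) by (auto simp: extend_rel_def extend_dom_def F.top_meet Rr)
    fix x assume x: "x \<in> carrier A"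
    show "extend_rel r x \<subseteq> extend_rel r (one A)"
      using R.r_sub[OF m[OF x]] F.U_leq(2) by (auto simp: extend_rel_def F.top_meet)
    show "extend_rel r (compl A x) = extend_rel r (one A) - extend_rel r x"
      using x F.U_leq(2,4) unfolding extend_rel_def F.top_meet(2) tm[OF x] Rr(3)[OF x] by auto
    show "extend_rel r (conv A x) = (extend_rel r x)\<inverse>"
      using x F.U_leq(5) unfolding extend_rel_def F.top_meet(5)[OF x] Rr(4)[OF x] by auto
    fix y assume y: "y \<in> carrier A"
    show "extend_rel r (join A x y) = extend_rel r x \<union> extend_rel r y"
      using x y F.U_leq(6) unfolding extend_rel_def F.top_meet(6)[OF x y] Rr(5)[OF x y] by auto
    show "extend_rel r (comp A x y) = extend_rel r x O extend_rel r y"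
      using x y F.U_leq(7) unfolding extend_rel_def F.top_meet(7)[OF x y] Rr(6)[OF x y] by blast
  qed
qed

lemma finite_A': "finite (carrier A')"
  using finite by simp

lemma representable_A': "representable A'"
proof -
  obtain B :: "nat set" and r where "flexible_rep A s e B r" using obtain_rep .
  then interpret flexible_rep A s e B r .
  show ?thesis unfolding representable_def using restrict_representation by blast
qed

lemma atoms_A': "atoms A' = {a \<in> atoms A. leq A a top'}"
proof -
  obtain B :: "nat set" and r where "flexible_rep A s e B r" using obtain_rep .
  then interpret flexible_rep A s e B r .
  interpret R: represented A' C r by unfold_locales (rule restrict_representation)
  show ?thesis
  proof (rule set_eqI)
    show "a \<in> atoms A' \<longleftrightarrow> a \<in> {a \<in> atoms A. leq A a top'}" for a
      unfolding R.atoms_iff mem_Collect_eq atoms_iff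
      by (simp add: leq_iff Ball_def del: r_simps(3) cong: conj_cong) blast
  qed
qed

lemma atoms_split: "atoms A = atoms A' \<union> U" "atoms A' \<inter> U = {}"
proof -
  obtain B :: "nat set" and r where "flexible_rep A s e B r" using obtain_rep .
  then interpret flexible_rep A s e B r .
  have "leq A a top' \<longleftrightarrow> \<not> leq A a u" if a: "a \<in> atoms A" for a
  proof -
    obtain p where p: "p \<in> r a" using a unfolding atoms_iff by auto
    have "p \<in> r top' \<longleftrightarrow> p \<notin> r u" using p r_sub[OF atom_carrier[OF a]] by auto
    then show ?thesis
      using atom_sub[OF a _ p] p atom_carrier[OF a] by (metis closed(4) leq_iff subsetD u_carrier)
  qed
  then show "atoms A = atoms A' \<union> U" "atoms A' \<inter> U = {}" by (auto simp: atoms_A' U_def)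
qed

lemma integral_A': "integral A'"
proof -
  obtain B :: "nat set" and r where "flexible_rep A s e B r" using obtain_rep .
  then interpret flexible_rep A s e B r .
  show ?thesis using e(1) by (auto simp: integral_def atoms_A' A'_leq r_e)
qed

text \<open>For elements of \<open>A'\<close>, being below \<open>e\<close> and being below the
  identity of \<open>A\<close> coincide. So flexibility of \<open>s\<close> in \<open>A'\<close> is
  its flexibility in \<open>A\<close> over fewer elements.\<close>

lemma flexible_A': "flexible A' s"
proof -
  obtain B :: "nat set" and r where "flexible_rep A s e B r" using obtain_rep .
  then interpret flexible_rep A s e B r .
  have sub: "a \<in> subidentities A \<longleftrightarrow> r a \<subseteq> Id" if "a \<in> carrier A" for a
    using that r_field[OF that] by (auto simp: subidentities_def leq_iff)
  have sub': "a \<in> subidentities A' \<longleftrightarrow> a \<in> subidentities A" if "a \<in> carrier A'" for a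
  proof -
    have "a \<in> carrier A" "r a \<subseteq> C \<times> C" using that A'_leq by auto
    moreover from this have "r a \<subseteq> Id_on C \<longleftrightarrow> r a \<subseteq> Id" by auto
    ultimately show ?thesis
      using sub that by (simp add: subidentities_def leq_iff r_e)
  qed
  have "s \<in> atoms A" "s \<notin> subidentities A" using flexible by (auto simp: flexible_def)
  moreover have "s \<notin> U"
  proof
    assume "s \<in> U"
    then have "r s \<subseteq> Id_on (B - C)" by (simp add: U_def leq_iff r_u)
    then show False using \<open>s \<notin> subidentities A\<close> by (auto simp: subidentities_def leq_iff)
  qed
  ultimately have "s \<in> atoms A'" using atoms_split(1) by blast
  moreover from this have "s \<in> carrier A'" by (simp add: atoms_def)
  ultimately have "s \<in> atoms A' - subidentities A'"
    using sub' \<open>s \<notin> subidentities A\<close> by blast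
  then show ?thesis using flexible sub' unfolding flexible_def by auto
qed

end

section \<open>Reductions between the network satisfaction problems\<close>

definition decode :: "'a option list \<Rightarrow> nat \<Rightarrow> (nat \<times> nat \<rightharpoonup> 'a)" where
  "decode w n = (\<lambda>(i, j). if i < n \<and> j < n then w ! (i * n + j) else None)"

lemma index_less: "i < n \<Longrightarrow> j < n \<Longrightarrow> i * n + j < n * (n :: nat)"
  using mult_le_mono1[of "Suc i" n n] by simp

lemma length_encode: "length (encode n g) = n * n"
  by (simp add: encode_def length_concat o_def sum_list_triv)

lemma concat_map_nth:
  assumes "i < m" "j < n"
  shows "concat (map (\<lambda>i. map (h i) [0..<n]) [0..<m]) ! (i * n + j) = h i j"
  using assms(1)
proof (induction m)
  case (Suc m)
  have len: "length (concat (map (\<lambda>i. map (h i) [0..<n]) [0..<m])) = m * n"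
    by (simp add: length_concat o_def sum_list_triv)
  show ?case
  proof (cases "i < m")
    case True
    then have "i * n + j < m * n" using mult_le_mono1[of "Suc i" m n] assms(2) by simp
    then show ?thesis using Suc True by (simp add: nth_append len)
  next
    case False
    then show ?thesis using Suc.prems assms(2) by (simp add: nth_append len less_Suc_eq)
  qed
qed simp

lemma encode_nth: "i < n \<Longrightarrow> j < n \<Longrightarrow> encode n g ! (i * n + j) = g (i, j)"
  unfolding encode_def by (rule concat_map_nth)

lemma decode_encode:
  assumes "dom g \<subseteq> {0..<n} \<times> {0..<n}"
  shows "decode (encode n g) n = g"
proof
  fix p :: "nat \<times> nat"
  obtain i j where p: "p = (i, j)" by (cases p)
  show "decode (encode n g) n p = g p"
  proof (cases "i < n \<and> j < n")
    case True
    then show ?thesis by (simp add: p decode_def encode_nth)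
  next
    case False
    then have "p \<notin> dom g" using assms p by auto
    then show ?thesis using False by (auto simp: p decode_def)
  qed
qed

lemma encode_decode:
  assumes "length w = n * n"
  shows "encode n (decode w n) = w"
proof (rule nth_equalityI)
  fix p assume "p < length (encode n (decode w n))"
  then have p: "p < n * n" by (simp add: length_encode)
  then have "p div n < n" "p mod n < n" by (auto simp: less_mult_imp_div_less intro!: mod_less_divisor gr0I)
  then show "encode n (decode w n) ! p = w ! p"
    using encode_nth[of "p div n" n "p mod n" "decode w n"] by (simp add: decode_def)
qed (simp add: length_encode assms)

lemma network_decode:
  assumes "set w \<subseteq> alphabet A" "length w = n * n"
  shows "network A {0..<n} (decode w n)"
proof -
  have "w ! (i * n + j) \<in> alphabet A" if "i < n" "j < n" for i j
    using assms index_less[OF that] by (auto simp: subset_iff)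
  then have "a \<in> carrier A" if "decode w n (i, j) = Some a" for i j a
    using that unfolding decode_def alphabet_def by (auto split: if_splits) force
  then have "ran (decode w n) \<subseteq> carrier A" by (auto simp: ran_def)
  moreover have "dom (decode w n) \<subseteq> {0..<n} \<times> {0..<n}" by (auto simp: decode_def split: if_splits)
  ultimately show ?thesis by (simp add: network_def)
qed

lemma NSP_iff:
  assumes "set w \<subseteq> alphabet A" "length w = n * n"
  shows "w \<in> NSP A \<longleftrightarrow> satisfiable A {0..<n} (decode w n)"
proof
  assume "w \<in> NSP A"
  then obtain m g where g: "w = encode m g" "network A {0..<m} g" "satisfiable A {0..<m} g"
    unfolding NSP_def by blast
  have "m = n" using assms(2) length_encode[of m g] g(1)
    by (metis power2_eq_square power2_eq_imp_eq zero_le)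
  then show "satisfiable A {0..<n} (decode w n)"
    using g decode_encode[of g n] unfolding network_def by simp
next
  assume "satisfiable A {0..<n} (decode w n)"
  then show "w \<in> NSP A"
    using network_decode[OF assms] encode_decode[OF assms(2)] unfolding NSP_def by force
qed

lemma NSP_square: "w \<in> NSP A \<Longrightarrow> \<exists>n. length w = n * n"
  unfolding NSP_def using length_encode by blast

section \<open>The fixpoint iteration on networks\<close>

context flexible_algebra
begin

text \<open>The values \<open>a\<close> and \<open>b\<close> bound the isolated points available to
  the two ends of an edge labelled \<open>c\<close>. Both ends must take the same point, with its
  loop in \<open>c\<close>, so both bounds shrink to the common part. An undefined label demands
  nothing.\<close>

fun refine :: "'a option \<Rightarrow> 'a option \<Rightarrow> 'a option \<Rightarrow> 'a option option" where
  "refine (Some c) (Some a) (Some b) =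
     (let v = meet A (meet A a b) c in if v = a \<and> v = b then None else Some (Some v))"
| "refine _ _ _ = None"

text \<open>The bound zero excludes isolated points and confines the edge to \<open>A'\<close>. With
  a nonzero bound the vertex will go to an isolated point, so its edge imposes nothing on the
  \<open>A'\<close>-network.\<close>

fun relabel :: "'a option \<Rightarrow> 'a option \<Rightarrow> 'a option" where
  "relabel (Some c) (Some b) = (if b = zero A then Some (meet A c top') else None)"
| "relabel _ _ = None"

text \<open>Strictly monotone by finiteness. A common lower bound of \<open>a\<close> and
  \<open>b\<close> that differs from one of them therefore has twice its rank below their
  sum.\<close>

fun rank :: "'a option \<Rightarrow> nat" where
  "rank (Some a) = card {x \<in> carrier A. leq A x a}"
| "rank None = 0"

lemma refine_eq_Some:
  "refine c a b = Some v \<Longrightarrow> \<exists>c' a' b'. c = Some c' \<and> a = Some a' \<and> b = Some b' \<and>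
     v = Some (meet A (meet A a' b') c') \<and> (meet A (meet A a' b') c' \<noteq> a' \<or> meet A (meet A a' b') c' \<noteq> b')"
  by (cases "(c, a, b)" rule: refine.cases) (auto simp: Let_def split: if_splits)

lemma Some_alphabet [simp]: "Some a \<in> alphabet A \<longleftrightarrow> a \<in> carrier A" "None \<in> alphabet A"
  by (auto simp: alphabet_def)

text \<open>With the unit as diagonal letter, the comparison of the tables merely intersects the two
  copies of a bound. Every bound starts at \<open>u\<close>, which excludes no isolated
  point.\<close>

sublocale grid_machine "alphabet A" "Some (one A)" "Some u" None refine relabel rank
proof -
  obtain B :: "nat set" and r where "flexible_rep A s e B r" using obtain_rep .
  then interpret flexible_rep A s e B r .
  show "grid_machine (alphabet A) (Some (one A)) (Some u) None refine relabel rank"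
  proof
    show "finite (alphabet A)" using finite by (simp add: alphabet_def)
    show "Some (one A) \<in> alphabet A" "Some u \<in> alphabet A" "None \<in> alphabet A" by simp_all
    show "relabel c b \<in> alphabet A" if "c \<in> alphabet A" "b \<in> alphabet A" for c b
      using that by (cases c; cases b) auto
    fix c a b v assume *: "c \<in> alphabet A" "a \<in> alphabet A" "b \<in> alphabet A" "refine c a b = Some v"
    obtain c' a' b' where eq: "c = Some c'" "a = Some a'" "b = Some b'"
      and v: "v = Some (meet A (meet A a' b') c')"
      and ne: "meet A (meet A a' b') c' \<noteq> a' \<or> meet A (meet A a' b') c' \<noteq> b'"
      using refine_eq_Some[OF *(4)] by blast
    have mem: "c' \<in> carrier A" "a' \<in> carrier A" "b' \<in> carrier A" using * eq by auto
    then show "v \<in> alphabet A" using v by simp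
    let ?v = "meet A (meet A a' b') c'"
    have mono: "rank (Some x) \<le> rank (Some y)" "x \<noteq> y \<Longrightarrow> rank (Some x) < rank (Some y)"
      if "x \<in> carrier A" "y \<in> carrier A" "r x \<subseteq> r y" for x y
    proof -
      have sub: "{z \<in> carrier A. leq A z x} \<subseteq> {z \<in> carrier A. leq A z y}"
        using that by (auto simp: leq_iff)
      then show "rank (Some x) \<le> rank (Some y)" using finite by (auto intro: card_mono)
      assume "x \<noteq> y"
      then have "y \<notin> {z \<in> carrier A. leq A z x}" "y \<in> {z \<in> carrier A. leq A z y}"
        using that eq_iff by (auto simp: leq_iff)
      then have "{z \<in> carrier A. leq A z x} \<subset> {z \<in> carrier A. leq A z y}" using sub by blast
      then show "rank (Some x) < rank (Some y)" using finite by (auto intro: psubset_card_mono)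
    qed
    have "r ?v \<subseteq> r a'" "r ?v \<subseteq> r b'" using mem by auto
    then show "2 * rank v < rank a + rank b"
      using mono[of ?v a'] mono[of ?v b'] mem ne unfolding v eq by fastforce
  qed
qed

text \<open>\<open>H k p\<close> expresses that the value \<open>p\<close> is admissible for the vertex \<open>k\<close>.\<close>

lemma changes_invariant:
  assumes run: "(change w n)\<^sup>*\<^sup>* (replicate n (Some u), replicate n (Some u)) (T1, T2)"
    and init: "\<And>k. k < n \<Longrightarrow> H k u"
    and diag: "\<And>k a b. \<lbrakk>k < n; H k a; H k b\<rbrakk> \<Longrightarrow> H k (meet A (meet A a b) (one A))"
    and cell: "\<And>x y a b c. \<lbrakk>x < n; y < n; decode w n (x, y) = Some c; H y a; H x b\<rbrakk> \<Longrightarrow>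
      H y (meet A (meet A a b) c) \<and> H x (meet A (meet A a b) c)"
  shows "length T1 = n \<and> length T2 = n \<and>
    (\<forall>k<n. (\<exists>p. T1 ! k = Some p \<and> H k p) \<and> (\<exists>p. T2 ! k = Some p \<and> H k p))"
  using run
proof (induction "(T1, T2)" arbitrary: T1 T2 rule: rtranclp_induct)
  case base
  then show ?case using init by auto
next
  case (step S)
  obtain S1 S2 where S: "S = (S1, S2)" by (cases S)
  have IH: "length S1 = n" "length S2 = n"
    "\<And>k. k < n \<Longrightarrow> \<exists>p. S1 ! k = Some p \<and> H k p" "\<And>k. k < n \<Longrightarrow> \<exists>p. S2 ! k = Some p \<and> H k p"
    using step.hyps(3)[OF S] by auto
  have upd: "\<exists>p. S[i := Some v] ! k = Some p \<and> H k p"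
    if "\<exists>p. S ! k = Some p \<and> H k p" "k < length S" "H i v" for S i v k
    using that by (cases "k = i") auto
  obtain i j v where "T1 = S1[i := Some v]" "T2 = S2[j := Some v]" "H i v" "H j v"
    using step.hyps(2) unfolding S
  proof cases
    case (diagonal k v)
    then show thesis
      using that[of k _ k] diag IH(3)[of k] IH(4)[of k] by (fastforce dest!: refine_eq_Some)
  next
    case (cell x y v)
    obtain a b where ab: "S1 ! y = Some a" "H y a" "S2 ! x = Some b" "H x b"
      using IH(3)[of y] IH(4)[of x] cell by blast
    obtain c where c: "w ! (x * n + y) = Some c" "v = Some (meet A (meet A a b) c)"
      using refine_eq_Some[OF cell(5)] ab by auto
    then have "decode w n (x, y) = Some c" using cell by (simp add: decode_def)
    then show thesis
      using that[of y _ x] c(2) assms(4)[OF cell(3,4) _ ab(2,4)] cell(1,2) by blast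
  qed
  then show ?case using IH upd by simp
qed

lemma stable_cell:
  assumes "stable w n T1 T2" "x < n" "y < n" "decode w n (x, y) = Some c"
    "T1 ! y = Some a" "T2 ! x = Some b"
  shows "a = b" "meet A (meet A a b) c = b"
proof -
  have "refine (w ! (x * n + y)) (T1 ! y) (T2 ! x) = None"
    using assms(1-3) unfolding stable_def by blast
  then have "refine (Some c) (Some a) (Some b) = None"
    using assms by (simp add: decode_def)
  then show "a = b" "meet A (meet A a b) c = b"
    by (auto simp: Let_def split: if_splits)
qed

lemma stable_diagonal:
  assumes "stable w n T1 T2" "k < n" "T1 ! k = Some a" "T2 ! k = Some b"
  shows "a = b"
proof -
  have "refine (Some (one A)) (T1 ! k) (T2 ! k) = None"
    using assms(1,2) unfolding stable_def by blast
  then show ?thesis using assms by (auto simp: Let_def split: if_splits)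
qed

lemma decode_result:
  "x < n \<Longrightarrow> y < n \<Longrightarrow> decode (result w n T) n (x, y) = relabel (decode w n (x, y)) (T ! x)"
  using index_less[of x n y] by (simp add: decode_def result_def)

lemma result_complete:
  assumes w: "set w \<subseteq> alphabet A" "length w = n * n"
    and run: "(change w n)\<^sup>*\<^sup>* (replicate n (Some u), replicate n (Some u)) (T1, T2)"
    and sat: "satisfiable A {0..<n} (decode w n)"
  shows "satisfiable A' {0..<n} (decode (result w n T2) n)"
proof -
  obtain B :: "nat set" and r t where rep: "representation A B r" and t: "t ` {0..<n} \<subseteq> B"
    and lab: "\<And>x y a. decode w n (x, y) = Some a \<Longrightarrow> (t x, t y) \<in> r a"
    using sat unfolding satisfiable_def satisfied_in_def by blast
  interpret flexible_rep A s e B r by unfold_locales (rule rep)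
  have net: "a \<in> carrier A" if "decode w n (x, y) = Some a" for x y a
    using network_decode[OF w] that unfolding network_def ran_def by blast
  \<comment> \<open>Only vertices sent outside \<open>C\<close> are tracked: their loops stay in
    every bound. A vertex whose bound becomes zero must thus lie in \<open>C\<close>.\<close>
  define H where "H k p \<longleftrightarrow> p \<in> carrier A \<and> (t k \<notin> C \<longrightarrow> (t k, t k) \<in> r p)" for k p
  have eq: "t x = t y" if "decode w n (x, y) = Some c" "t x \<notin> C \<or> t y \<notin> C" for x y c
  proof -
    have "(t x, t y) \<in> r (one A)" using lab net r_sub that(1) by blast
    then show ?thesis using that(2) by (cases rule: one_cases) auto
  qed
  have "H y (meet A (meet A a b) c) \<and> H x (meet A (meet A a b) c)"
    if "decode w n (x, y) = Some c" "H y a" "H x b" for x y a b c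
    using that lab[OF that(1)] net[OF that(1)] eq[OF that(1)] unfolding H_def by auto
  moreover have "H k u" if "k < n" for k
    using t that by (auto simp: H_def r_u)
  moreover have "H k (meet A (meet A a b) (one A))" if "k < n" "H k a" "H k b" for k a b
  proof -
    have "t k \<in> B" using t that(1) by auto
    then show ?thesis using that one_refl by (simp add: H_def)
  qed
  ultimately have T2: "\<exists>p. T2 ! k = Some p \<and> H k p" if "k < n" for k
    using changes_invariant[OF run, of H] that by blast
  \<comment> \<open>A default for vertices placed outside \<open>C\<close>; no surviving label
    touches them.\<close>
  obtain c0 where c0: "c0 \<in> C" using C_nonempty by blast
  define t' where "t' x = (if t x \<in> C then t x else c0)" for x
  have "(t' x, t' y) \<in> r b" if b: "decode (result w n T2) n (x, y) = Some b" for x y b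
  proof -
    have xy: "x < n" "y < n" using b by (auto simp: decode_def split: if_splits)
    obtain p where p: "T2 ! x = Some p" "H x p" using T2 xy(1) by blast
    then obtain c where c: "decode w n (x, y) = Some c" "p = zero A" "b = meet A c top'"
      using b unfolding decode_result[OF xy] by (cases "decode w n (x, y)") (auto split: if_splits)
    then have "t x \<in> C" using p by (auto simp: H_def)
    then have "t y \<in> C" using eq[OF c(1)] by metis
    then show ?thesis
      using lab[OF c(1)] net[OF c(1)] r_sub[OF net[OF c(1)]] \<open>t x \<in> C\<close> c(3)
      by (auto simp: t'_def r_top simp del: r_simps(3))
  qed
  moreover have "t' ` {0..<n} \<subseteq> C" using c0 by (auto simp: t'_def)
  ultimately show ?thesis
    using restrict_representation unfolding satisfiable_def satisfied_in_def by blast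
qed

lemma satisfiable_extend:
  assumes "network A V g" "representation A' B r" "t ` V \<subseteq> extend_dom B"
    "\<And>x y a. g (x, y) = Some a \<Longrightarrow> (t x, t y) \<in> extend_rel r a"
  shows "satisfiable A V g"
proof (rule satisfiableI)
  show "satisfied_in A (extend_dom B) (extend_rel r) V g"
    using extend_representation assms unfolding satisfied_in_def by blast
qed (use assms finite in \<open>auto intro: countable_finite\<close>)

lemma result_sound:
  assumes w: "set w \<subseteq> alphabet A" "length w = n * n"
    and run: "(change w n)\<^sup>*\<^sup>* (replicate n (Some u), replicate n (Some u)) (T1, T2)"
    and stable: "stable w n T1 T2"
    and sat: "satisfiable A' {0..<n} (decode (result w n T2) n)"
  shows "satisfiable A {0..<n} (decode w n)"
proof -
  obtain B0 :: "nat set" and r0 where "flexible_rep A s e B0 r0" using obtain_rep .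
  then interpret flexible_rep A s e B0 r0 .
  obtain B :: "nat set" and r t where rep: "representation A' B r" and t: "t ` {0..<n} \<subseteq> B"
    and lab: "\<And>x y a. decode (result w n T2) n (x, y) = Some a \<Longrightarrow> (t x, t y) \<in> r a"
    using sat unfolding satisfiable_def satisfied_in_def by blast
  have net: "a \<in> carrier A" if "decode w n (x, y) = Some a" for x y a
    using network_decode[OF w] that unfolding network_def ran_def by blast
  \<comment> \<open>All bounds stay below \<open>u\<close>, so each nonzero one has a member of
    \<open>U\<close> below it.\<close>
  define H where "H k p \<longleftrightarrow> p \<in> carrier A \<and> r0 p \<subseteq> r0 u" for k :: nat and p
  have inv: "length T1 = n \<and> length T2 = n \<and>
    (\<forall>k<n. (\<exists>p. T1 ! k = Some p \<and> H k p) \<and> (\<exists>p. T2 ! k = Some p \<and> H k p))"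
  proof (rule changes_invariant[OF run])
    show "H y (meet A (meet A a b) c) \<and> H x (meet A (meet A a b) c)"
      if "decode w n (x, y) = Some c" "H y a" "H x b" for x y a b c
      using that net[OF that(1)] by (auto simp: H_def)
  qed (auto simp: H_def)
  obtain P where P: "\<And>k. k < n \<Longrightarrow> T2 ! k = Some (P k) \<and> H k (P k)"
    using inv by metis
  have P1: "T1 ! k = Some (P k)" if "k < n" for k
    using inv stable_diagonal[OF stable that] P[OF that] that by blast
  \<comment> \<open>The choice depends only on the bound. Adjacent vertices have equal bounds at the
    fixpoint and so receive the same point.\<close>
  define pick where "pick p = (SOME j. j \<in> U \<and> leq A j p)" for p
  have pick: "pick p \<in> U \<and> leq A (pick p) p" if "H k p" "p \<noteq> zero A" for k p
  proof -
    have p: "p \<in> carrier A" "r0 p \<subseteq> r0 u" using that by (auto simp: H_def)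
    then have "r0 p \<noteq> {}" using that(2) eq_iff[of p "zero A"] by simp
    then obtain x y where xy: "(x, y) \<in> r0 p" by auto
    then have "(x, y) \<notin> C \<times> C" using p by (auto simp: r_u)
    then obtain j where "j \<in> U" "leq A j p" using exists_U[OF p(1) xy] by blast
    then show ?thesis unfolding pick_def by (metis (mono_tags, lifting) someI_ex)
  qed
  define t' where "t' x = (if P x = zero A then Inl (t x) else Inr (pick (P x)))" for x
  show ?thesis
  proof (rule satisfiable_extend[OF network_decode[OF w] rep])
    show "t' ` {0..<n} \<subseteq> extend_dom B"
      using t P pick by (fastforce simp: t'_def extend_dom_def)
    fix x y c assume c: "decode w n (x, y) = Some c"
    then have xy: "x < n" "y < n" by (auto simp: decode_def split: if_splits)
    have eq: "P y = P x" "meet A (meet A (P y) (P x)) c = P x"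
      using stable_cell[OF stable xy c] P1[OF xy(2)] P[OF xy(1)] by auto
    show "(t' x, t' y) \<in> extend_rel r c"
    proof (cases "P x = zero A")
      case True
      then have "decode (result w n T2) n (x, y) = Some (meet A c top')"
        using P[OF xy(1)] by (simp add: decode_result[OF xy] c)
      then show ?thesis using lab True eq(1) by (simp add: t'_def extend_rel_def)
    next
      case False
      have j: "pick (P x) \<in> U" "leq A (pick (P x)) (P x)"
        using pick P[OF xy(1)] False by blast+
      have Px: "P x \<in> carrier A" using P[OF xy(1)] by (simp add: H_def)
      then have "r0 (P x) = r0 (P x) \<inter> r0 c"
        using eq net[OF c] by (metis Int_absorb meet_closed r_meet)
      moreover have "pick (P x) \<in> carrier A" using j(1) atom_carrier by (simp add: U_def)
      ultimately have "leq A (pick (P x)) c"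
        using j(2) Px net[OF c] by (auto simp: leq_iff)
      then show ?thesis using False eq(1) j(1) by (simp add: t'_def extend_rel_def)
    qed
  qed
qed

lemma reduction_to_A':
  "polytime_reducible (alphabet A) (NSP A) (alphabet A') (NSP A')"
proof -
  obtain B0 :: "nat set" and r0 where "flexible_rep A s e B0 r0" using obtain_rep .
  then interpret R: flexible_rep A s e B0 r0 .
  obtain f where f: "polytime_computable (alphabet A) f"
    and nonsquare: "\<And>w. \<lbrakk>set w \<subseteq> alphabet A; \<nexists>n. length w = n * n\<rbrakk> \<Longrightarrow> f w = replicate (length w) None"
    and square: "\<And>w n. \<lbrakk>set w \<subseteq> alphabet A; length w = n * n\<rbrakk> \<Longrightarrow> \<exists>T1 T2. f w = result w n T2 \<and>
       (change w n)\<^sup>*\<^sup>* (replicate n (Some u), replicate n (Some u)) (T1, T2) \<and> stable w n T1 T2 \<and>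
       length T1 = n \<and> length T2 = n \<and> set T1 \<subseteq> alphabet A \<and> set T2 \<subseteq> alphabet A"
    using polytime_computable_fixpoint by blast
  have relabel: "relabel c b \<in> alphabet A'" if "c \<in> alphabet A" "b \<in> alphabet A" for c b
    using that by (cases c; cases b) (auto simp: alphabet_def R.leq_iff)
  have "f w \<in> lists (alphabet A') \<and> (w \<in> NSP A \<longleftrightarrow> f w \<in> NSP A')" if "w \<in> lists (alphabet A)" for w
  proof (cases "\<exists>n. length w = n * n")
    case True
    then obtain n where n: "length w = n * n" by blast
    have w: "set w \<subseteq> alphabet A" using that by auto
    obtain T1 T2 where T: "f w = result w n T2"
      "(change w n)\<^sup>*\<^sup>* (replicate n (Some u), replicate n (Some u)) (T1, T2)" "stable w n T1 T2"
      "length T2 = n" "set T2 \<subseteq> alphabet A"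
      using square[OF w n] by blast
    have fw: "set (f w) \<subseteq> alphabet A'"
    proof -
      have "relabel (w ! p) (T2 ! (p div n)) \<in> alphabet A'" if "p < n * n" for p
        using that w T(4,5) n by (intro relabel) (auto simp: subset_iff less_mult_imp_div_less)
      then show ?thesis unfolding T(1) result_def by auto
    qed
    moreover have "length (f w) = n * n" unfolding T(1) by (simp add: result_def)
    ultimately have "f w \<in> NSP A' \<longleftrightarrow> satisfiable A' {0..<n} (decode (f w) n)"
      by (rule NSP_iff)
    then show ?thesis
      using NSP_iff[OF w n] result_complete[OF w n T(2)] result_sound[OF w n T(2,3)] fw
      unfolding T(1) by (auto simp: in_lists_conv_set)
  next
    case False
    then have "f w = replicate (length w) None" using that by (intro nonsquare) auto
    then show ?thesis using False NSP_square[of w A] NSP_square[of "f w" A']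
      by (auto simp: alphabet_def)
  qed
  then show ?thesis using f unfolding polytime_reducible_def by blast
qed

lemma reduction_from_A':
  "polytime_reducible (alphabet A') (NSP A') (alphabet A) (NSP A)"
proof -
  have sub: "alphabet A' \<subseteq> alphabet A" by (auto simp: alphabet_def)
  have "w \<in> NSP A' \<longleftrightarrow> w \<in> NSP A" if w: "set w \<subseteq> alphabet A'" for w
  proof (cases "\<exists>n. length w = n * n")
    case True
    then obtain n where n: "length w = n * n" by blast
    have net': "network A' {0..<n} (decode w n)" using network_decode[OF w n] .
    have net: "network A {0..<n} (decode w n)" using network_decode[OF _ n] w sub by blast
    have lab: "a \<in> carrier A" "leq A a top'" if "decode w n (x, y) = Some a" for x y a
      using net' that unfolding network_def ran_def by auto
    have dom: "x < n" "y < n" if "decode w n (x, y) = Some a" for x y a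
      using that by (auto simp: decode_def split: if_splits)
    have "satisfiable A {0..<n} (decode w n)" if sat: "satisfiable A' {0..<n} (decode w n)"
    proof -
      obtain B0 :: "nat set" and r0 where "flexible_rep A s e B0 r0" using obtain_rep .
      then interpret flexible_rep A s e B0 r0 .
      obtain B :: "nat set" and r t where rep: "representation A' B r" and t: "t ` {0..<n} \<subseteq> B"
        and t_lab: "\<And>x y a. decode w n (x, y) = Some a \<Longrightarrow> (t x, t y) \<in> r a"
        using sat unfolding satisfiable_def satisfied_in_def by blast
      show ?thesis
      proof (rule satisfiable_extend[OF net rep])
        show "(Inl \<circ> t) ` {0..<n} \<subseteq> extend_dom B" using t by (auto simp: extend_dom_def)
        fix x y a assume a: "decode w n (x, y) = Some a"
        have "meet A a top' = a" using lab[OF a] by (auto simp: eq_iff leq_iff)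
        then show "((Inl \<circ> t) x, (Inl \<circ> t) y) \<in> extend_rel r a"
          using t_lab[OF a] by (simp add: extend_rel_def)
      qed
    qed
    moreover have "satisfiable A' {0..<n} (decode w n)" if sat: "satisfiable A {0..<n} (decode w n)"
    proof -
      obtain B :: "nat set" and r t where rep: "representation A B r"
        and t_lab: "\<And>x y a. decode w n (x, y) = Some a \<Longrightarrow> (t x, t y) \<in> r a"
        using sat unfolding satisfiable_def satisfied_in_def by blast
      interpret flexible_rep A s e B r by unfold_locales (rule rep)
      \<comment> \<open>Labels from \<open>A'\<close> relate only points of \<open>C\<close>, so a
        vertex moved to \<open>c0\<close> carries no label.\<close>
      obtain c0 where c0: "c0 \<in> C" using C_nonempty by blast
      define t' where "t' x = (if t x \<in> C then t x else c0)" for x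
      have "(t' x, t' y) \<in> r a" if a: "decode w n (x, y) = Some a" for x y a
        using t_lab[OF a] lab[OF a] by (auto simp: A'_leq t'_def)
      moreover have "t' ` {0..<n} \<subseteq> C" using c0 by (auto simp: t'_def)
      ultimately show ?thesis
        using restrict_representation unfolding satisfiable_def satisfied_in_def by blast
    qed
    ultimately show ?thesis using NSP_iff[OF w n] NSP_iff[of w A n] w sub n by blast
  next
    case False
    then show ?thesis using NSP_square by blast
  qed
  then have "\<forall>w\<in>lists (alphabet A'). w \<in> lists (alphabet A) \<and> (w \<in> NSP A' \<longleftrightarrow> w \<in> NSP A)"
    using sub by (auto simp: in_lists_conv_set)
  moreover have "polytime_computable (alphabet A') (\<lambda>w. w)"
    using finite by (intro polytime_computable_id) (simp add: alphabet_def)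
  ultimately show ?thesis unfolding polytime_reducible_def by blast
qed

end

section \<open>Siggers polymorphisms\<close>

text \<open>Transposes the tuples into one argument list per coordinate. The relations also require
  the results to be atoms, so each equivalence in the proof assumes that \<open>f\<close> maps atoms
  to atoms.\<close>

lemma polymorphism_atom_structure:
  "polymorphism n f (atom_structure A) \<longleftrightarrow>
    (\<forall>xs. set xs \<subseteq> atoms A \<longrightarrow> length xs = n \<longrightarrow> f xs \<in> atoms A) \<and>
    (\<forall>x\<in>carrier A. \<forall>xs. set xs \<subseteq> atoms A \<longrightarrow> length xs = n \<longrightarrow>
       (\<forall>a\<in>set xs. leq A a x) \<longrightarrow> leq A (f xs) x) \<and>
    (\<forall>xs ys. set xs \<subseteq> atoms A \<longrightarrow> set ys \<subseteq> atoms A \<longrightarrow> length xs = n \<longrightarrow> length ys = n \<longrightarrow>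
       (\<forall>i<n. conv A (xs ! i) = ys ! i) \<longrightarrow> conv A (f xs) = f ys) \<and>
    (\<forall>xs ys zs. set xs \<subseteq> atoms A \<longrightarrow> set ys \<subseteq> atoms A \<longrightarrow> set zs \<subseteq> atoms A \<longrightarrow>
       length xs = n \<longrightarrow> length ys = n \<longrightarrow> length zs = n \<longrightarrow>
       (\<forall>i<n. leq A (zs ! i) (comp A (xs ! i) (ys ! i))) \<longrightarrow> leq A (f zs) (comp A (f xs) (f ys)))"
  (is "?L \<longleftrightarrow> ?C \<and> ?R1 \<and> ?R2 \<and> ?R3")
proof -
  let ?U = "\<lambda>x. {[a] | a. a \<in> atoms A \<and> leq A a x}"
  let ?V = "{[a1, a2] | a1 a2. a1 \<in> atoms A \<and> a2 \<in> atoms A \<and> conv A a1 = a2}"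
  let ?T = "{[a1, a2, a3] | a1 a2 a3. a1 \<in> atoms A \<and> a2 \<in> atoms A \<and> a3 \<in> atoms A \<and>
              leq A a3 (comp A a1 a2)}"
  let ?c = "\<lambda>ts i. map (\<lambda>t. t ! i) ts"
  have upt: "[0..<1] = [0]" "[0..<2] = [0, 1]" "[0..<3] = [0, 1, 2 :: nat]"
    by (simp_all add: numeral_2_eq_2 numeral_3_eq_3)
  define Q where "Q k R \<longleftrightarrow> (\<forall>ts. set ts \<subseteq> R \<longrightarrow> length ts = n \<longrightarrow> map (\<lambda>i. f (?c ts i)) [0..<k] \<in> R)"
    for k R
  have "?L \<longleftrightarrow> ?C \<and> (\<forall>(k, R)\<in>struct_rels (atom_structure A). Q k R)"
    unfolding polymorphism_def Q_def lists_eq_set by (simp add: atom_structure_def Ball_def)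
  also have "\<dots> \<longleftrightarrow> ?C \<and> (\<forall>x\<in>carrier A. Q 1 (?U x)) \<and> Q 2 ?V \<and> Q 3 ?T"
    unfolding atom_structure_def rel_structure.simps by blast
  finally have L: "?L \<longleftrightarrow> ?C \<and>
      (\<forall>x\<in>carrier A. \<forall>ts. set ts \<subseteq> ?U x \<longrightarrow> length ts = n \<longrightarrow> [f (?c ts 0)] \<in> ?U x) \<and>
      (\<forall>ts. set ts \<subseteq> ?V \<longrightarrow> length ts = n \<longrightarrow> [f (?c ts 0), f (?c ts 1)] \<in> ?V) \<and>
      (\<forall>ts. set ts \<subseteq> ?T \<longrightarrow> length ts = n \<longrightarrow> [f (?c ts 0), f (?c ts 1), f (?c ts 2)] \<in> ?T)"
    (is "_ \<longleftrightarrow> ?C \<and> ?P1 \<and> ?P2 \<and> ?P3")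
    unfolding Q_def upt list.map .
  have P1: "?P1 \<longleftrightarrow> ?R1" if C: ?C
  proof (intro iffI ballI allI impI)
    fix x xs assume *: ?P1 "x \<in> carrier A" "set xs \<subseteq> atoms A" "length xs = n" "\<forall>a\<in>set xs. leq A a x"
    let ?ts = "map (\<lambda>a. [a]) xs"
    have "set ?ts \<subseteq> ?U x" using *(3,5) by auto
    then have "[f (?c ?ts 0)] \<in> ?U x"
      using *(1)[THEN bspec, OF *(2), THEN spec, of ?ts] *(4) by simp
    then show "leq A (f xs) x" by (simp add: o_def)
  next
    fix x ts assume *: ?R1 "x \<in> carrier A" "set ts \<subseteq> ?U x" "length ts = n"
    have el: "t ! 0 \<in> atoms A \<and> leq A (t ! 0) x" if "t \<in> set ts" for t
      using subsetD[OF *(3) that] by auto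
    have "set (?c ts 0) \<subseteq> atoms A" "\<forall>a\<in>set (?c ts 0). leq A a x" using el by auto
    then show "[f (?c ts 0)] \<in> ?U x"
      using *(1)[THEN bspec, OF *(2), THEN spec, of "?c ts 0"] C[THEN spec, of "?c ts 0"] *(4) by simp
  qed
  have P2: "?P2 \<longleftrightarrow> ?R2" if C: ?C
  proof (intro iffI allI impI)
    fix xs ys assume *: ?P2 "set xs \<subseteq> atoms A" "set ys \<subseteq> atoms A" "length xs = n" "length ys = n"
      "\<forall>i<n. conv A (xs ! i) = ys ! i"
    let ?ts = "map (\<lambda>i. [xs ! i, ys ! i]) [0..<n]"
    have "[xs ! i, ys ! i] \<in> ?V" if "i < n" for i
      using *(6) subsetD[OF *(2) nth_mem, of i] subsetD[OF *(3) nth_mem, of i] *(4,5) that by simp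
    then have "set ?ts \<subseteq> ?V" by (simp add: image_subset_iff)
    then have "[f (?c ?ts 0), f (?c ?ts 1)] \<in> ?V"
      using *(1)[THEN spec, of ?ts] by simp
    then show "conv A (f xs) = f ys" using *(4,5) map_nth[of xs] map_nth[of ys] by (simp add: o_def)
  next
    fix ts assume *: ?R2 "set ts \<subseteq> ?V" "length ts = n"
    have el: "t ! 0 \<in> atoms A \<and> t ! 1 \<in> atoms A \<and> conv A (t ! 0) = t ! 1" if "t \<in> set ts" for t
      using subsetD[OF *(2) that] by auto
    have "\<forall>i<n. conv A (?c ts 0 ! i) = ?c ts 1 ! i" "set (?c ts 0) \<subseteq> atoms A" "set (?c ts 1) \<subseteq> atoms A"
      using el nth_mem *(3) by auto
    then show "[f (?c ts 0), f (?c ts 1)] \<in> ?V"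
      using *(1)[THEN spec, THEN spec, of "?c ts 0" "?c ts 1"] *(3)
        C[THEN spec, of "?c ts 0"] C[THEN spec, of "?c ts 1"] by simp
  qed
  have P3: "?P3 \<longleftrightarrow> ?R3" if C: ?C
  proof (intro iffI allI impI)
    fix xs ys zs assume *: ?P3 "set xs \<subseteq> atoms A" "set ys \<subseteq> atoms A" "set zs \<subseteq> atoms A"
      "length xs = n" "length ys = n" "length zs = n"
      "\<forall>i<n. leq A (zs ! i) (comp A (xs ! i) (ys ! i))"
    let ?ts = "map (\<lambda>i. [xs ! i, ys ! i, zs ! i]) [0..<n]"
    have "[xs ! i, ys ! i, zs ! i] \<in> ?T" if "i < n" for i
      using *(8) subsetD[OF *(2) nth_mem, of i] subsetD[OF *(3) nth_mem, of i]
        subsetD[OF *(4) nth_mem, of i] *(5-7) that by simp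
    then have "set ?ts \<subseteq> ?T" by (simp add: image_subset_iff)
    then have "[f (?c ?ts 0), f (?c ?ts 1), f (?c ?ts 2)] \<in> ?T"
      using *(1)[THEN spec, of ?ts] by simp
    then show "leq A (f zs) (comp A (f xs) (f ys))" using *(5-7) map_nth[of xs] map_nth[of ys] map_nth[of zs]
      by (simp add: o_def)
  next
    fix ts assume *: ?R3 "set ts \<subseteq> ?T" "length ts = n"
    have el: "t ! 0 \<in> atoms A \<and> t ! 1 \<in> atoms A \<and> t ! 2 \<in> atoms A \<and>
        leq A (t ! 2) (comp A (t ! 0) (t ! 1))" if "t \<in> set ts" for t
      using subsetD[OF *(2) that] by auto
    have "\<forall>i<n. leq A (?c ts 2 ! i) (comp A (?c ts 0 ! i) (?c ts 1 ! i))"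
      "set (?c ts 0) \<subseteq> atoms A" "set (?c ts 1) \<subseteq> atoms A" "set (?c ts 2) \<subseteq> atoms A"
      using el nth_mem *(3) by auto
    then show "[f (?c ts 0), f (?c ts 1), f (?c ts 2)] \<in> ?T"
      using *(1)[THEN spec, THEN spec, THEN spec, of "?c ts 0" "?c ts 1" "?c ts 2"] *(3)
        C[THEN spec, of "?c ts 0"] C[THEN spec, of "?c ts 1"] C[THEN spec, of "?c ts 2"] by simp
  qed
  show ?thesis unfolding L
  proof (rule conj_cong[OF refl])
    assume C: ?C
    show "?P1 \<and> ?P2 \<and> ?P3 \<longleftrightarrow> ?R1 \<and> ?R2 \<and> ?R3"
      by (simp only: P1[OF C] P2[OF C] P3[OF C])
  qed
qed

section \<open>Atoms below \<open>u\<close> in the relations of the atom structure\<close>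

context flexible_rep
begin

lemma atom_eqI:
  assumes "a \<in> atoms A" "b \<in> atoms A" "p \<in> r a" "p \<in> r b"
  shows "a = b"
  using atom_sub[OF assms(1) atom_carrier[OF assms(2)] assms(3,4)]
    atom_sub[OF assms(2) atom_carrier[OF assms(1)] assms(4,3)] assms(1,2) atom_carrier eq_iff by blast

lemma U_rel: "j \<in> U \<Longrightarrow> r j \<subseteq> Id_on (B - C)"
  using atom_carrier by (auto simp: U_def leq_iff r_u[symmetric])

lemma U_conv:
  assumes "a \<in> carrier A" "a \<in> U \<or> conv A a \<in> U"
  shows "conv A a = a"
proof -
  have "r a \<subseteq> Id" using assms U_rel[of a] U_rel[of "conv A a"] by auto
  then have "r (conv A a) = r a" using assms(1) by auto
  then show ?thesis using assms(1) eq_iff by simp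
qed

text \<open>An atom of \<open>U\<close> contains only loops at isolated points. In a witness
  \<open>p\<close>, \<open>z\<close>, \<open>q\<close> of the composition all three points then
  coincide, and atoms sharing a loop are equal.\<close>

lemma U_comp:
  assumes "a \<in> atoms A" "b \<in> atoms A" "c \<in> atoms A" "leq A c (comp A a b)" "a \<in> U \<or> b \<in> U \<or> c \<in> U"
  shows "a = b" "c = b"
proof -
  have mem: "a \<in> carrier A" "b \<in> carrier A" "c \<in> carrier A" using assms(1-3) atom_carrier by auto
  obtain p q where pq: "(p, q) \<in> r c" using atom_nonempty[OF assms(3)] by auto
  then obtain z where z: "(p, z) \<in> r a" "(z, q) \<in> r b" using assms(4) mem by (auto simp: leq_iff)
  have one: "(p, q) \<in> r (one A)" "(p, z) \<in> r (one A)" "(z, q) \<in> r (one A)"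
    using r_sub mem pq z by blast+
  have "p = z \<and> z = q"
    using assms(5) pq z U_rel off_diagonal[OF one(1)] off_diagonal[OF one(2)] off_diagonal[OF one(3)]
    by blast
  then show "a = b" "c = b" using atom_eqI[of _ b "(p, p)"] assms(1-3) pq z by auto
qed

end

context flexible_algebra
begin

text \<open>The unary relation of \<open>top'\<close> is preserved, so the given polymorphism
  restricts to the atoms of \<open>A'\<close>.\<close>

lemma siggers_A':
  assumes "has_siggers_polymorphism (atom_structure A)"
  shows "has_siggers_polymorphism (atom_structure A')"
proof -
  obtain B :: "nat set" and r where "flexible_rep A s e B r" using obtain_rep .
  then interpret flexible_rep A s e B r .
  obtain f where f: "polymorphism 6 f (atom_structure A)" "siggers_identity f (atoms A)"
    using assms unfolding has_siggers_polymorphism_def by (auto simp: atom_structure_def)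
  have sub: "atoms A' \<subseteq> atoms A" using atoms_split(1) by blast
  have "f xs \<in> atoms A'" if "set xs \<subseteq> atoms A'" "length xs = 6" for xs
  proof -
    have "f xs \<in> atoms A" "leq A (f xs) top'"
      using f(1) that sub unfolding polymorphism_atom_structure by (auto simp: atoms_A' subset_iff)
    then show ?thesis by (simp add: atoms_A')
  qed
  then have "polymorphism 6 f (atom_structure A')"
    using f(1) sub unfolding polymorphism_atom_structure A'_simps leq_A' by (auto dest!: subset_trans[OF _ sub])
  moreover have "siggers_identity f (atoms A')"
    using f(2) sub unfolding siggers_identity_def by blast
  ultimately show ?thesis
    unfolding has_siggers_polymorphism_def by (auto simp: atom_structure_def)
qed

lemma U_part_eq:
  assumes "length xs = length ys" "\<And>i. i < length xs \<Longrightarrow> xs ! i \<in> U \<or> ys ! i \<in> U \<Longrightarrow> xs ! i = ys ! i"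
  shows "set xs \<inter> U = set ys \<inter> U"
  using assms by (auto simp: in_set_conv_nth) metis+

text \<open>Since a triple of the composition relation that meets \<open>U\<close> is constant, choosing an argument in \<open>U\<close>,
  if there is one, by a rule that only sees the set of these arguments extends the given polymorphism.\<close>

lemma siggers_A:
  assumes "has_siggers_polymorphism (atom_structure A')"
  shows "has_siggers_polymorphism (atom_structure A)"
proof -
  obtain B :: "nat set" and r where "flexible_rep A s e B r" using obtain_rep .
  then interpret flexible_rep A s e B r .
  obtain g where g: "polymorphism 6 g (atom_structure A')" "siggers_identity g (atoms A')"
    using assms unfolding has_siggers_polymorphism_def by (auto simp: atom_structure_def)
  define f where "f xs = (if set xs \<inter> U = {} then g xs else SOME a. a \<in> set xs \<inter> U)" for xs
  have f_U: "f xs \<in> set xs \<inter> U" if "set xs \<inter> U \<noteq> {}" for xs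
    using that some_in_eq[of "set xs \<inter> U"] by (simp add: f_def)
  have f_cong: "f xs = f ys" if "set xs \<inter> U = set ys \<inter> U" "set xs \<inter> U \<noteq> {}" for xs ys
    using that by (simp add: f_def)
  have f_g: "f xs = g xs" if "set xs \<inter> U = {}" for xs using that by (simp add: f_def)
  have A': "set xs \<subseteq> atoms A'" if "set xs \<subseteq> atoms A" "set xs \<inter> U = {}" for xs
    using that atoms_split by blast
  note gp = g(1)[unfolded polymorphism_atom_structure A'_simps leq_A']
  note g1 = gp[THEN conjunct1, rule_format]
    and g2 = gp[THEN conjunct2, THEN conjunct1, rule_format]
    and g3 = gp[THEN conjunct2, THEN conjunct2, THEN conjunct1, rule_format]
    and g4 = gp[THEN conjunct2, THEN conjunct2, THEN conjunct2, rule_format]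
  have carrier: "a \<in> carrier A" if "a \<in> atoms A" for a using that by (rule atom_carrier)
  \<comment> \<open>Preservation by \<open>g\<close> is given only for elements below
    \<open>top'\<close>, hence the detour through \<open>meet A x top'\<close>.\<close>
  have g_leq: "leq A (g xs) x" if x: "x \<in> carrier A" and xs: "set xs \<subseteq> atoms A'" "length xs = 6"
    and le: "\<forall>a\<in>set xs. leq A a x" for x xs
  proof -
    have m: "meet A x top' \<in> {a \<in> carrier A. leq A a top'}" using x by (simp add: leq_iff)
    have "leq A a (meet A x top')" if "a \<in> set xs" for a
    proof -
      have "a \<in> carrier A" "leq A a top'" "leq A a x"
        using that xs(1) carrier le by (auto simp: atoms_A')
      then show ?thesis using x by (simp add: leq_iff)
    qed
    then have "leq A (g xs) (meet A x top')" using g2[OF m xs] by blast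
    moreover have "g xs \<in> carrier A" using g1[OF xs] carrier by (simp add: atoms_A')
    ultimately show ?thesis using x by (simp add: leq_iff)
  qed
  have "polymorphism 6 f (atom_structure A)"
    unfolding polymorphism_atom_structure
  proof (intro conjI allI impI ballI)
    show "f xs \<in> atoms A" if "set xs \<subseteq> atoms A" "length xs = 6" for xs
    proof (cases "set xs \<inter> U = {}")
      case True
      then show ?thesis using g1[OF A'[OF that(1) True] that(2)] atoms_split(1) by (simp add: f_g)
    qed (use f_U[of xs] that in blast)
    show "leq A (f xs) x" if "x \<in> carrier A" "set xs \<subseteq> atoms A" "length xs = 6" "\<forall>a\<in>set xs. leq A a x"
      for x xs
    proof (cases "set xs \<inter> U = {}")
      case True
      then show ?thesis using g_leq[OF that(1) A'[OF that(2) True] that(3,4)] by (simp add: f_g)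
    qed (use f_U[of xs] that in blast)
  next
    fix xs ys assume *: "set xs \<subseteq> atoms A" "set ys \<subseteq> atoms A" "length xs = 6" "length ys = 6"
      "\<forall>i<6. conv A (xs ! i) = ys ! i"
    have "xs ! i = ys ! i" if i: "i < 6" "xs ! i \<in> U \<or> ys ! i \<in> U" for i
    proof -
      have "xs ! i \<in> carrier A" using carrier subsetD[OF *(1) nth_mem] *(3) i(1) by simp
      then show ?thesis using U_conv[of "xs ! i"] *(5) i by metis
    qed
    then have eq: "set xs \<inter> U = set ys \<inter> U" using *(3,4) by (intro U_part_eq) auto
    show "conv A (f xs) = f ys"
    proof (cases "set xs \<inter> U = {}")
      case True
      then have "set ys \<inter> U = {}" using eq by simp
      then show ?thesis
        using g3[OF A'[OF *(1) True] A'[OF *(2)] *(3,4)] *(5) True by (simp add: f_g)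
    next
      case False
      then have "f xs \<in> U" using f_U by blast
      then show ?thesis
        using U_conv[of "f xs"] f_cong[OF eq False] carrier by (simp add: U_def)
    qed
  next
    fix xs ys zs assume *: "set xs \<subseteq> atoms A" "set ys \<subseteq> atoms A" "set zs \<subseteq> atoms A"
      "length xs = 6" "length ys = 6" "length zs = 6"
      "\<forall>i<6. leq A (zs ! i) (comp A (xs ! i) (ys ! i))"
    have eqs: "xs ! i = ys ! i \<and> zs ! i = ys ! i"
      if i: "i < 6" "xs ! i \<in> U \<or> ys ! i \<in> U \<or> zs ! i \<in> U" for i
    proof -
      have "xs ! i \<in> atoms A" "ys ! i \<in> atoms A" "zs ! i \<in> atoms A"
        using subsetD[OF *(1) nth_mem] subsetD[OF *(2) nth_mem] subsetD[OF *(3) nth_mem] *(4-6) i(1)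
        by simp_all
      then show ?thesis using U_comp[of "xs ! i" "ys ! i" "zs ! i"] *(7) i by blast
    qed
    have "set xs \<inter> U = set ys \<inter> U"
    proof (rule U_part_eq)
      show "xs ! i = ys ! i" if "i < length xs" "xs ! i \<in> U \<or> ys ! i \<in> U" for i
        using eqs[of i] that *(4) by metis
    qed (use *(4,5) in simp)
    moreover have "set zs \<inter> U = set ys \<inter> U"
    proof (rule U_part_eq)
      show "zs ! i = ys ! i" if "i < length zs" "zs ! i \<in> U \<or> ys ! i \<in> U" for i
        using eqs[of i] that *(6) by metis
    qed (use *(5,6) in simp)
    ultimately have eq: "set xs \<inter> U = set ys \<inter> U" "set zs \<inter> U = set ys \<inter> U" .
    show "leq A (f zs) (comp A (f xs) (f ys))"
    proof (cases "set ys \<inter> U = {}")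
      case True
      then have none: "set xs \<inter> U = {}" "set zs \<inter> U = {}" using eq by auto
      show ?thesis
        using g4[OF A'[OF *(1) none(1)] A'[OF *(2) True] A'[OF *(3) none(2)] *(4-6)] *(7) True none
        by (simp add: f_g)
    next
      case False
      then have "f xs = f ys" "f zs = f ys" using f_cong[of xs ys] f_cong[of zs ys] eq by simp_all
      moreover have "f ys \<in> U" using f_U False by blast
      moreover from this have "f ys \<in> carrier A" using carrier by (simp add: U_def)
      ultimately show ?thesis using U_leq(7)[of "f ys" "f ys" "f ys"] by (simp add: leq_iff)
    qed
  qed
  moreover have "f [x, x, y, y, z, z] = f [y, z, x, z, x, y]"
    if "x \<in> atoms A" "y \<in> atoms A" "z \<in> atoms A" for x y z
  proof (cases "set [x, x, y, y, z, z] \<inter> U = {}")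
    case True
    then have "x \<in> atoms A'" "y \<in> atoms A'" "z \<in> atoms A'" using that atoms_split by auto
    then have "g [x, x, y, y, z, z] = g [y, z, x, z, x, y]"
      using g(2) unfolding siggers_identity_def by blast
    then show ?thesis using True by (simp add: f_def)
  next
    case False
    \<comment> \<open>Both argument lists have the entries \<open>x\<close>, \<open>y\<close>,
      \<open>z\<close>, and the choice sees only the set of those in \<open>U\<close>.\<close>
    show ?thesis by (rule f_cong[OF _ False]) auto
  qed
  then have "siggers_identity f (atoms A)" unfolding siggers_identity_def by blast
  ultimately show ?thesis
    unfolding has_siggers_polymorphism_def by (auto simp: atom_structure_def)
qed

end

text \<open>Take \<open>e\<close> to be the atom containing the loop at the first point of some pair
  in \<open>s\<close>. Then \<open>comp A e s\<close> meets the atom \<open>s\<close> and so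
  contains it.\<close>

lemma flexible_algebra_exists:
  assumes "finite (carrier A)" "representable A" "flexible A s"
  obtains e where "flexible_algebra A s e"
proof -
  obtain B :: "nat set" and r where "representation A B r"
    using assms(2) unfolding representable_def by blast
  then interpret represented A B r by unfold_locales
  have s: "s \<in> atoms A" using assms(3) by (simp add: flexible_def)
  then have sc: "s \<in> carrier A" by (rule atom_carrier)
  obtain p q where pq: "(p, q) \<in> r s" using atom_nonempty[OF s] by auto
  then have "(p, p) \<in> r (ident A)" using r_field[OF sc] by auto
  then obtain e where e: "e \<in> atoms A" "(p, p) \<in> r e" "r e \<subseteq> r (ident A)"
    using exists_atom[OF assms(1) closed(3)] by blast
  then have ec: "e \<in> carrier A" using atom_carrier by blast
  have "(p, q) \<in> r (comp A e s)" using e pq ec sc by auto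
  then have "leq A s (comp A e s)"
    using atom_sub[OF s closed(7)[OF ec sc] pq] sc ec by (simp add: leq_iff)
  then have "flexible_algebra A s e"
    using assms e ec by unfold_locales (simp_all add: leq_iff)
  then show thesis by (rule that)
qed

theorem proposition3p3:
  fixes A :: "'a rel_alg"
  assumes "finite (carrier A)"
    and "representable A"
    and "\<exists>s. flexible A s"
  shows "\<exists>A' :: 'a rel_alg.
    finite (carrier A') \<and> integral A' \<and> representable A' \<and> (\<exists>s. flexible A' s) \<and>
    polytime_reducible (alphabet A) (NSP A) (alphabet A') (NSP A') \<and>
    polytime_reducible (alphabet A') (NSP A') (alphabet A) (NSP A) \<and>
    (has_siggers_polymorphism (atom_structure A) \<longleftrightarrow>
     has_siggers_polymorphism (atom_structure A'))"
proof -
  obtain s where s: "flexible A s" using assms(3) by blast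
  obtain e where "flexible_algebra A s e" by (rule flexible_algebra_exists[OF assms(1,2) s])
  then interpret flexible_algebra A s e .
  show ?thesis
  proof (intro exI[of _ A'] conjI)
    show "\<exists>s. flexible A' s" using flexible_A' by blast
    show "has_siggers_polymorphism (atom_structure A) \<longleftrightarrow> has_siggers_polymorphism (atom_structure A')"
      using siggers_A siggers_A' by blast
  qed (fact finite_A' integral_A' representable_A' reduction_to_A' reduction_from_A')+
qed

end
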